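(* Let $\varepsilon:\mathbb{R}\to\mathbb{R}$ be a function that is not $C^1$ and that is $\frac{1}{4\pi}$-Lipschitz, let $\mathcal{F}$ be the foliation of $\mathbb{A}$ into the graphs of $\theta\in\mathbb{T}\mapsto c+\varepsilon(c)\cos(2\pi\theta)$, $c\in\mathbb{R}$, and let $u(\theta,c)=\frac{\varepsilon(c)}{2\pi}\sin(2\pi\theta)$ be its generating function. Then $\mathcal{F}$ cannot be straightened via an exact symplectic homeomorphism that preserves the horizontal orientation of the leaves. Even locally, in any neighbourhood of a point where $u$ is not $C^1$ (that is, any neighbourhood of $(\theta_0,c_0+\varepsilon(c_0)\cos(2\pi\theta_0))$, where $u$ is not $C^1$ on any neighbourhood of $(\theta_0,c_0)$), $\mathcal{F}$ cannot be straightened via an exact symplectic homeomorphism that preserves the horizontal orientation of the leaves.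
   Context: $\mathbb{T}=\mathbb{R}/\mathbb{Z}$, $\mathbb{A}=\mathbb{T}\times\mathbb{R}$ with coordinates $(\theta,r)$ and symplectic form $-d(r\,d\theta)$. A diffeomorphism $\phi$ is exact symplectic if $\phi^*(r\,d\theta)-r\,d\theta$ is exact. An exact symplectic homeomorphism from an open set $\mathcal U$ onto an open set $\mathcal V$ (open subsets of $\mathbb{A}$ or $\mathbb{R}^2$) is a homeomorphism that is the limit, for the $C^0$ compact-open topology, of a sequence of exact symplectic diffeomorphisms. The standard horizontal foliation has the sets $\{\text{second coordinate}=c\}$ as leaves. A foliation of $\mathcal V$ is straightened via an exact symplectic homeomorphism if there is an exact symplectic homeomorphism $\Phi:\mathcal U\to\mathcal V$ mapping the standard horizontal foliation of $\mathcal U$ onto this foliation; it preserves the horizontal orientation of the leaves if, for each $c$, $x\mapsto$ (first coordinate of $\Phi(x,c)$) is orientation preserving. Globally, $\mathcal U=\mathcal V=\mathbb{A}$; locally, $\mathcal V$ is a neighbourhood of the point under consideration, with the restriction of $\mathcal F$ to $\mathcal V$. The generating function of a continuous foliation of $\mathbb{A}$ into graphs is the unique continuous $u:\mathbb{A}\to\mathbb{R}$, $C^1$ in the $\mathbb{T}$ variable, with $u(0,c)=0$ for all $c$ and such that for all $c\in\mathbb{R}$ the graph of $c+\frac{\partial u}{\partial\theta}(\cdot,c)$ is a leaf. *)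

theory Defs
  imports "HOL-Analysis.Analysis"
begin

section \<open>The circle \<open>\<real>/\<int>\<close> and the annulus\<close>

quotient_type circle = real / "\<lambda>x y. x - y \<in> \<int>"
proof (rule equivpI)
  show "reflp (\<lambda>x y::real. x - y \<in> \<int>)" by (simp add: reflp_def)
  show "symp (\<lambda>x y::real. x - y \<in> \<int>)"
    unfolding symp_def by (metis Ints_minus minus_diff_eq)
  show "transp (\<lambda>x y::real. x - y \<in> \<int>)"
    unfolding transp_def by (metis Ints_add diff_add_cancel add_diff_eq)
qed

instantiation circle :: topological_space
begin

definition open_circle :: "circle set \<Rightarrow> bool" where
  "open_circle S \<longleftrightarrow> open (abs_circle -` S)"

instance
proof
  show "open (UNIV :: circle set)" by (simp add: open_circle_def)
  show "open (S \<inter> T)" if "open S" "open T" for S T :: "circle set"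
    using that by (simp add: open_circle_def open_Int)
  show "open (\<Union>K)" if "\<forall>S\<in>K. open S" for K :: "circle set set"
    using that by (simp add: open_circle_def vimage_Union open_UN)
qed

end

text \<open>The class has just the two instances \<open>real\<close> and \<open>circle\<close>, so that
  \<open>'a \<times> real\<close> stands for the plane and for the annulus.  The map \<open>cover\<close> is the
  identity in the first case and the projection to \<open>\<real>/\<int>\<close> in the second.  The
  differentiable structure of \<open>'a \<times> real\<close> is the one that makes \<open>cover2\<close> a local
  diffeomorphism.\<close>

class coordinate_line = topological_space +
  fixes cover :: "real \<Rightarrow> 'a"
  assumes surj_cover: "surj cover"
    and open_iff_open_vimage_cover: "open S \<longleftrightarrow> open (cover -` S)"

instantiation real :: coordinate_line
begin
definition cover_real :: "real \<Rightarrow> real" where "cover_real x = x"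
instance by standard (auto simp: cover_real_def vimage_def surj_def)
end

instantiation circle :: coordinate_line
begin
definition cover_circle :: "real \<Rightarrow> circle" where "cover_circle = abs_circle"
instance
proof
  show "surj (cover :: real \<Rightarrow> circle)"
    unfolding cover_circle_def surj_def by (metis Quotient3_abs_rep Quotient3_circle)
qed (simp add: cover_circle_def open_circle_def)
end

type_synonym annulus = "circle \<times> real"
type_synonym plane = "real \<times> real"

definition cover2 :: "real \<times> real \<Rightarrow> 'a::coordinate_line \<times> real" where
  "cover2 z = (cover (fst z), snd z)"

lift_definition cos_turn :: "circle \<Rightarrow> real" is "\<lambda>t. cos (2 * pi * t)"
proof -
  fix s t :: real assume "s - t \<in> \<int>"
  then obtain n where "s = t + of_int n"
    by (metis Ints_cases add.commute diff_add_cancel)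
  then show "cos (2 * pi * s) = cos (2 * pi * t)"
    by (simp add: distrib_left cos_add)
qed

lift_definition sin_turn :: "circle \<Rightarrow> real" is "\<lambda>t. sin (2 * pi * t)"
proof -
  fix s t :: real assume "s - t \<in> \<int>"
  then obtain n where "s = t + of_int n"
    by (metis Ints_cases add.commute diff_add_cancel)
  then show "sin (2 * pi * s) = sin (2 * pi * t)"
    by (simp add: distrib_left sin_add)
qed

section \<open>Regularity\<close>

definition C1_on :: "'a::real_normed_vector set \<Rightarrow> ('a \<Rightarrow> 'b::real_normed_vector) \<Rightarrow> bool" where
  "C1_on W F \<longleftrightarrow> (\<exists>F' :: 'a \<Rightarrow> 'a \<Rightarrow>\<^sub>L 'b.
     (\<forall>w\<in>W. (F has_derivative blinfun_apply (F' w)) (at w)) \<and> continuous_on W F')"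

definition C1_function_on :: "('a::coordinate_line \<times> real) set \<Rightarrow> ('a \<times> real \<Rightarrow> real) \<Rightarrow> bool" where
  "C1_function_on W u \<longleftrightarrow> C1_on (cover2 -` W) (u \<circ> cover2)"

definition local_lift ::
  "('a::coordinate_line \<times> real) set \<Rightarrow> ('a \<times> real \<Rightarrow> 'b::coordinate_line \<times> real)
     \<Rightarrow> (real \<times> real) set \<Rightarrow> (real \<times> real \<Rightarrow> real \<times> real) \<Rightarrow> bool" where
  "local_lift U f W F \<longleftrightarrow> open W \<and> cover2 ` W \<subseteq> U \<and> continuous_on W F \<and>
     (\<forall>w\<in>W. cover2 (F w) = f (cover2 w))"

definition C1_map_on ::
  "('a::coordinate_line \<times> real) set \<Rightarrow> ('a \<times> real \<Rightarrow> 'b::coordinate_line \<times> real) \<Rightarrow> bool" where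
  "C1_map_on U f \<longleftrightarrow> (\<forall>z. cover2 z \<in> U \<longrightarrow> (\<exists>W F. z \<in> W \<and> local_lift U f W F \<and> C1_on W F))"

section \<open>Exact symplectic maps\<close>

definition C1_diffeomorphism ::
  "('a::coordinate_line \<times> real) set \<Rightarrow> ('b::coordinate_line \<times> real) set
     \<Rightarrow> ('a \<times> real \<Rightarrow> 'b \<times> real) \<Rightarrow> bool" where
  "C1_diffeomorphism U V f \<longleftrightarrow> open U \<and> open V \<and> C1_map_on U f \<and>
     (\<exists>g. homeomorphism U V f g \<and> C1_map_on V g)"

text \<open>\<open>f\<^sup>*(r d\<theta>) - r d\<theta> = dS\<close> on \<open>U\<close>, evaluated at \<open>z\<close> on the vector \<open>h\<close> and read in
  the cover; the left-hand side does not depend on the chosen local lift \<open>F\<close>.\<close>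

definition exact_symplectic_on ::
  "('a::coordinate_line \<times> real) set \<Rightarrow> ('a \<times> real \<Rightarrow> 'b::coordinate_line \<times> real) \<Rightarrow> bool" where
  "exact_symplectic_on U f \<longleftrightarrow> (\<exists>S :: 'a \<times> real \<Rightarrow> real. \<forall>W F. local_lift U f W F \<longrightarrow>
     (\<forall>z\<in>W. ((S \<circ> cover2) has_derivative
        (\<lambda>h. snd (F z) * fst (frechet_derivative F (at z) h) - snd z * fst h)) (at z)))"

definition exact_symplectic_diffeo ::
  "('a::coordinate_line \<times> real) set \<Rightarrow> ('b::coordinate_line \<times> real) set
     \<Rightarrow> ('a \<times> real \<Rightarrow> 'b \<times> real) \<Rightarrow> bool" where
  "exact_symplectic_diffeo U V f \<longleftrightarrow> C1_diffeomorphism U V f \<and> exact_symplectic_on U f"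

text \<open>The compact-open topology on the continuous maps on \<open>U\<close>.  Values outside \<open>U\<close> are
  irrelevant: maps that agree on \<open>U\<close> have the same neighbourhoods.\<close>

definition compact_open_topology ::
  "'a::topological_space set \<Rightarrow> ('a \<Rightarrow> 'b::topological_space) topology" where
  "compact_open_topology U = topology_generated_by
     {{f. continuous_on U f \<and> f ` K \<subseteq> V} | K V. compact K \<and> K \<subseteq> U \<and> open V}"

text \<open>The approximating maps are diffeomorphisms of \<open>U\<close> onto open sets of the ambient surface,
  which need not be \<open>V\<close>.\<close>

definition exact_symplectic_homeo ::
  "('a::coordinate_line \<times> real) set \<Rightarrow> ('b::coordinate_line \<times> real) set
     \<Rightarrow> ('a \<times> real \<Rightarrow> 'b \<times> real) \<Rightarrow> bool" where
  "exact_symplectic_homeo U V \<Phi> \<longleftrightarrow> open U \<and> open V \<and> (\<exists>\<Psi>. homeomorphism U V \<Phi> \<Psi>) \<and>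
     (\<exists>\<phi> :: nat \<Rightarrow> 'a \<times> real \<Rightarrow> 'b \<times> real.
        (\<forall>n. exact_symplectic_diffeo U (\<phi> n ` U) (\<phi> n)) \<and>
        limitin (compact_open_topology U) \<phi> \<Phi> sequentially)"

section \<open>Foliations\<close>

text \<open>A foliation is represented by its set of leaves.\<close>

definition leaf_of :: "('a \<Rightarrow> real) \<Rightarrow> ('a \<times> real) set" where
  "leaf_of \<eta> = {(\<theta>, \<eta> \<theta>) | \<theta>. True}"

definition continuous_graph_foliation :: "annulus set set \<Rightarrow> bool" where
  "continuous_graph_foliation \<F> \<longleftrightarrow> (\<exists>\<eta> :: real \<Rightarrow> circle \<Rightarrow> real.
     (\<exists>g. homeomorphism UNIV UNIV (\<lambda>(\<theta>, c). (\<theta>, \<eta> c \<theta>)) g) \<and>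
     \<F> = range (\<lambda>c. leaf_of (\<eta> c)))"

definition generating_function :: "annulus set set \<Rightarrow> (annulus \<Rightarrow> real) \<Rightarrow> bool" where
  "generating_function \<F> u \<longleftrightarrow> continuous_on UNIV u \<and> (\<forall>c. u (cover 0, c) = 0) \<and>
     (\<forall>c. \<exists>D :: circle \<Rightarrow> real. continuous_on UNIV D \<and>
        (\<forall>t. ((\<lambda>s. u (cover s, c)) has_real_derivative D (cover t)) (at t)) \<and>
        leaf_of (\<lambda>\<theta>. c + D \<theta>) \<in> \<F>)"

definition horizontal_foliation :: "('a \<times> real) set set" where
  "horizontal_foliation = range (\<lambda>c. UNIV \<times> {c})"

text \<open>The leaves of the restriction of a foliation to an open set \<open>V\<close> are the connected
  components of the traces on \<open>V\<close> of the leaves.\<close>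

definition restrict_foliation :: "'a::topological_space set set \<Rightarrow> 'a set \<Rightarrow> 'a set set" where
  "restrict_foliation \<F> V = (\<Union>L\<in>\<F>. components (L \<inter> V))"

text \<open>\<open>x \<mapsto> fst (\<Phi> (x, c))\<close> is orientation preserving: in the cover it is locally given by
  increasing continuous functions.\<close>

definition preserves_horizontal_orientation ::
  "('a::coordinate_line \<times> real) set \<Rightarrow> ('a \<times> real \<Rightarrow> 'b::coordinate_line \<times> real) \<Rightarrow> bool" where
  "preserves_horizontal_orientation U \<Phi> \<longleftrightarrow> (\<forall>x c. (cover x, c) \<in> U \<longrightarrow>
     (\<exists>\<delta>>0. \<exists>g :: real \<Rightarrow> real. continuous_on {x-\<delta><..<x+\<delta>} g \<and> strict_mono_on {x-\<delta><..<x+\<delta>} g \<and>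
        (\<forall>t\<in>{x-\<delta><..<x+\<delta>}. (cover t, c) \<in> U \<and> cover (g t) = fst (\<Phi> (cover t, c)))))"

definition straightens_oriented ::
  "('a::coordinate_line \<times> real) set \<Rightarrow> ('b::coordinate_line \<times> real) set
     \<Rightarrow> ('b \<times> real) set set \<Rightarrow> ('a \<times> real \<Rightarrow> 'b \<times> real) \<Rightarrow> bool" where
  "straightens_oriented U V \<F> \<Phi> \<longleftrightarrow> exact_symplectic_homeo U V \<Phi> \<and>
     image \<Phi> ` restrict_foliation horizontal_foliation U = restrict_foliation \<F> V \<and>
     preserves_horizontal_orientation U \<Phi>"

end

theory Submission
  imports Defs
begin

text \<open>Write \<open>E(x, k) = (x, k + \<epsilon>(k) cos(2\<pi>x))\<close> for the coordinates of the plane in which the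
  leaves are the lines \<open>k = const\<close> (\<open>leaf_chart\<close>).  The foliation fails to be
  straightenable because area is a rigid quantity that a straightening would have to compute in two
  ways.

  An exact symplectic diffeomorphism has Jacobian determinant \<open>1\<close> (\<open>det_eq_1_of_exact\<close>): the
  primitive \<open>S\<close> is \<open>C\<^sup>1\<close> only, but once a suitable combination of the first coordinates of source and
  image is added to it, its derivative is differentiable at a given point, and the symmetry of the second derivative there is exactly the equation \<open>det = 1\<close>.  So such a map preserves area, and
  this survives in the \<open>C\<^sup>0\<close> limit when the limit is a homeomorphism (\<open>area_comparison_in_limit\<close>):
  outer regularity bounds the area of a compact set by that of its image, and Brouwer's theorem,
  which prevents the nearby images from missing interior points, gives the other inequality.

  Now let \<open>\<Phi>\<close> be a straightening near a point of the leaf \<open>c\<^sub>0\<close>.  Read in the cover, \<open>\<Phi>\<^sup>-\<^sup>1 \<circ> E\<close> sends lines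
  \<open>k = const\<close> to horizontal lines, so it has the form \<open>(x, k) \<mapsto> (A(x, k), C(k))\<close>.  The area of the image under \<open>E\<close>
  of \<open>[a, b] \<times> [k\<^sub>1, k\<^sub>2]\<close> is
  \<open>(b - a) (k\<^sub>2 - k\<^sub>1) + (\<epsilon>(k\<^sub>2) - \<epsilon>(k\<^sub>1)) (sin 2\<pi>b - sin 2\<pi>a) / 2\<pi>\<close>,
  while its preimage under \<open>\<Phi>\<close>, sliced horizontally, has area
  \<open>\<bar>A(b, l) - A(a, l)\<bar> \<bar>C(k\<^sub>2) - C(k\<^sub>1)\<bar>\<close> up to a factor tending to \<open>1\<close> as \<open>k\<^sub>1, k\<^sub>2 \<rightarrow> l\<close>.
  After division by \<open>k\<^sub>2 - k\<^sub>1\<close> two difference quotients are unknown, that of \<open>\<epsilon>\<close> and that of \<open>C\<close>.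
  The quotient of the equations for \<open>(a, b)\<close> and \<open>(a, b')\<close> eliminates the second, and what remains is a
  Moebius function of the difference quotient of \<open>\<epsilon>\<close> that has a limit.  It is not constant as soon as
  the points of the graph of \<open>sin 2\<pi>x\<close> over \<open>a, b, b'\<close> are not collinear, and such points exist on
  every interval.  Hence the difference quotient itself converges: \<open>\<epsilon>\<close> is strictly differentiable at
  every \<open>l\<close> near \<open>c\<^sub>0\<close> (\<open>strict_derivative_of_plane_straightening\<close>), so \<open>\<epsilon>\<close> is \<open>C\<^sup>1\<close> near \<open>c\<^sub>0\<close>, and
  with it the generating function.  A global straightening would make \<open>\<epsilon>\<close> a \<open>C\<^sup>1\<close> function on the whole line.\<close>

section \<open>Exact symplectic maps have determinant one\<close>

text \<open>The mean value theorem in the first variable turns the second difference of \<open>g\<close> over a square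
  of side \<open>t\<close> into a first difference of \<open>p = \<partial>g/\<partial>x\<close>, where differentiability of \<open>p\<close> at the one
  point \<open>(x0, y0)\<close> is enough.\<close>

lemma second_difference_estimate:
  fixes g p :: "real \<times> real \<Rightarrow> real"
  assumes r: "r > 0"
    and g: "\<And>x y. (x, y) \<in> ball (x0, y0) r \<Longrightarrow> ((\<lambda>s. g (s, y)) has_real_derivative p (x, y)) (at x)"
    and p: "(p has_derivative p') (at (x0, y0))"
    and e: "e > 0"
  shows "\<exists>d>0. \<forall>t. 0 < t \<and> t < d \<longrightarrow>
    \<bar>g (x0 + t, y0 + t) - g (x0 + t, y0) - g (x0, y0 + t) + g (x0, y0) - t\<^sup>2 * p' (0, 1)\<bar> \<le> e * t\<^sup>2"
proof -
  have lin: "linear p'" using p has_derivative_linear by blast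
  from p[unfolded has_derivative_at_alt] e
  obtain d where d: "d > 0"
    and est: "\<And>z. norm (z - (x0, y0)) < d \<Longrightarrow> norm (p z - p (x0, y0) - p' (z - (x0, y0))) \<le> e/4 * norm (z - (x0, y0))"
    by (metis divide_pos_pos zero_less_numeral)
  have "\<bar>g (x0 + t, y0 + t) - g (x0 + t, y0) - g (x0, y0 + t) + g (x0, y0) - t\<^sup>2 * p' (0, 1)\<bar> \<le> e * t\<^sup>2"
    if t: "0 < t" "t < min d r / 2" for t
  proof -
    have nrm: "norm (\<xi>, \<eta>) \<le> 2 * t" if "0 \<le> \<xi>" "\<xi> \<le> t" "0 \<le> \<eta>" "\<eta> \<le> t" for \<xi> \<eta> :: real
      using norm_Pair_le[of \<xi> \<eta>] that by auto
    have inb: "(x0 + \<xi>, y0 + \<eta>) \<in> ball (x0, y0) r" if "0 \<le> \<xi>" "\<xi> \<le> t" "0 \<le> \<eta>" "\<eta> \<le> t" for \<xi> \<eta>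
    proof -
      have "dist (x0, y0) (x0 + \<xi>, y0 + \<eta>) = norm (\<xi>, \<eta>)"
        by (simp add: dist_norm norm_Pair)
      then show ?thesis using nrm[OF that] t by auto
    qed
    let ?\<phi> = "\<lambda>x. g (x, y0 + t) - g (x, y0)"
    have "\<exists>z. x0 < z \<and> z < x0 + t \<and> ?\<phi> (x0 + t) - ?\<phi> x0 = (x0 + t - x0) * (p (z, y0 + t) - p (z, y0))"
    proof (rule MVT2)
      show "x0 < x0 + t" using t by simp
      fix x assume "x0 \<le> x" "x \<le> x0 + t"
      then have "(x, y0 + t) \<in> ball (x0, y0) r" "(x, y0) \<in> ball (x0, y0) r"
        using inb[of "x - x0" t] inb[of "x - x0" 0] t by auto
      then show "(?\<phi> has_real_derivative p (x, y0 + t) - p (x, y0)) (at x)"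
        by (intro DERIV_diff g)
    qed
    then obtain z where z: "x0 < z" "z < x0 + t"
      and eq: "?\<phi> (x0 + t) - ?\<phi> x0 = t * (p (z, y0 + t) - p (z, y0))" by auto
    define \<xi> where "\<xi> = z - x0"
    have b1: "norm (p (z, y0 + t) - p (x0, y0) - p' (\<xi>, t)) \<le> e/4 * (2 * t)"
    proof -
      have n: "norm (\<xi>, t) \<le> 2 * t" using nrm[of \<xi> t] z t by (auto simp: \<xi>_def)
      have "norm (p (z, y0 + t) - p (x0, y0) - p' (\<xi>, t)) \<le> e/4 * norm (\<xi>, t)"
        using est[of "(z, y0 + t)"] n t by (simp add: \<xi>_def)
      also have "\<dots> \<le> e/4 * (2 * t)" using n e by (intro mult_left_mono) auto
      finally show ?thesis .
    qed
    have b2: "norm (p (z, y0) - p (x0, y0) - p' (\<xi>, 0)) \<le> e/4 * (2 * t)"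
    proof -
      have n: "norm (\<xi>, 0::real) \<le> 2 * t" using nrm[of \<xi> 0] z t by (auto simp: \<xi>_def)
      have "norm (p (z, y0) - p (x0, y0) - p' (\<xi>, 0)) \<le> e/4 * norm (\<xi>, 0::real)"
        using est[of "(z, y0)"] n t by (simp add: \<xi>_def)
      also have "\<dots> \<le> e/4 * (2 * t)" using n e by (intro mult_left_mono) auto
      finally show ?thesis .
    qed
    have "p' (\<xi>, t) - p' (\<xi>, 0) = p' (t *\<^sub>R (0, 1))"
      using linear_diff[OF lin, of "(\<xi>, t)" "(\<xi>, 0)"] by simp
    also have "\<dots> = t * p' (0, 1)" using linear_scale[OF lin, of t "(0,1)"] by simp
    finally have lt: "p' (\<xi>, t) - p' (\<xi>, 0) = t * p' (0, 1)" .
    have "\<bar>p (z, y0 + t) - p (z, y0) - t * p' (0, 1)\<bar> \<le> e * t"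
      using b1 b2 lt unfolding real_norm_def by linarith
    then have "t * \<bar>p (z, y0 + t) - p (z, y0) - t * p' (0, 1)\<bar> \<le> t * (e * t)"
      using t by (intro mult_left_mono) auto
    moreover have "g (x0 + t, y0 + t) - g (x0 + t, y0) - g (x0, y0 + t) + g (x0, y0) - t\<^sup>2 * p' (0, 1)
        = t * (p (z, y0 + t) - p (z, y0) - t * p' (0, 1))"
      using eq by (simp add: algebra_simps power2_eq_square)
    ultimately have "\<bar>g (x0 + t, y0 + t) - g (x0 + t, y0) - g (x0, y0 + t) + g (x0, y0) - t\<^sup>2 * p' (0, 1)\<bar>
        \<le> t * (e * t)"
      using t by (simp only: abs_mult)
    then show ?thesis by (simp only: power2_eq_square mult_ac)
  qed
  moreover have "min d r / 2 > 0" using d r by simp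
  ultimately show ?thesis by blast
qed

text \<open>The second difference is symmetric in the two variables, so the estimate above computes its
  leading term in two ways.  Differentiability of \<open>p\<close> and \<open>q\<close> at the single point \<open>z0\<close> is all that
  a \<open>C\<^sup>1\<close> map will provide.\<close>

lemma mixed_partials_eq:
  fixes g p q :: "real \<times> real \<Rightarrow> real"
  assumes W: "open W" "z0 \<in> W"
    and g: "\<And>z. z \<in> W \<Longrightarrow> (g has_derivative (\<lambda>h. p z * fst h + q z * snd h)) (at z)"
    and p: "(p has_derivative p') (at z0)"
    and q: "(q has_derivative q') (at z0)"
  shows "p' (0, 1) = q' (1, 0)"
proof -
  obtain x0 y0 where z0: "z0 = (x0, y0)" by (cases z0)
  obtain r where r: "r > 0" "ball (x0, y0) r \<subseteq> W" using W z0 openE by blast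
  have gx: "((\<lambda>s. g (s, y)) has_real_derivative p (x, y)) (at x)" if "(x, y) \<in> ball (x0, y0) r" for x y
  proof -
    have "((\<lambda>s. g (s, y)) has_derivative (\<lambda>h. p (x, y) * fst (h, 0::real) + q (x, y) * snd (h, 0::real))) (at x)"
      by (rule has_derivative_compose[where f="\<lambda>s. (s, y)", OF _ g]) (use that r in \<open>auto intro!: derivative_eq_intros\<close>)
    then show ?thesis by (simp add: has_field_derivative_def)
  qed
  have gy: "((\<lambda>s. g (x, s)) has_real_derivative q (x, y)) (at y)" if "(x, y) \<in> ball (x0, y0) r" for x y
  proof -
    have "((\<lambda>s. g (x, s)) has_derivative (\<lambda>h. p (x, y) * fst (0::real, h) + q (x, y) * snd (0::real, h))) (at y)"
      by (rule has_derivative_compose[where f="\<lambda>s. (x, s)", OF _ g]) (use that r in \<open>auto intro!: derivative_eq_intros\<close>)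
    then show ?thesis by (simp add: has_field_derivative_def)
  qed
  have q_swap: "((q \<circ> prod.swap) has_derivative (q' \<circ> prod.swap)) (at (y0, x0))"
  proof -
    have "(prod.swap has_derivative prod.swap) (at (y0, x0))" for y0 x0 :: real
      unfolding prod.swap_def[abs_def] by (auto intro!: derivative_eq_intros)
    then show ?thesis unfolding comp_def
      by (rule has_derivative_compose) (use q z0 in simp)
  qed
  have "\<bar>p' (0, 1) - q' (1, 0)\<bar> \<le> 2 * e" if e: "e > 0" for e
  proof -
    obtain d1 where d1: "d1 > 0" "\<And>t. 0 < t \<Longrightarrow> t < d1 \<Longrightarrow>
      \<bar>g (x0 + t, y0 + t) - g (x0 + t, y0) - g (x0, y0 + t) + g (x0, y0) - t\<^sup>2 * p' (0, 1)\<bar> \<le> e * t\<^sup>2"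
      using second_difference_estimate[OF r(1) gx p[unfolded z0] e] by metis
    have gy': "((\<lambda>s. (g \<circ> prod.swap) (s, y)) has_real_derivative (q \<circ> prod.swap) (x, y)) (at x)"
      if "(x, y) \<in> ball (y0, x0) r" for x y
      using gy[of y x] that by (simp add: dist_prod_def algebra_simps)
    obtain d2 where d2: "d2 > 0" "\<And>t. 0 < t \<Longrightarrow> t < d2 \<Longrightarrow>
      \<bar>g (x0 + t, y0 + t) - g (x0, y0 + t) - g (x0 + t, y0) + g (x0, y0) - t\<^sup>2 * q' (1, 0)\<bar> \<le> e * t\<^sup>2"
      using second_difference_estimate[OF r(1) gy' q_swap e] by auto
    define t where "t = min d1 d2 / 2"
    have t: "0 < t" "t < d1" "t < d2" using d1(1) d2(1) by (auto simp: t_def)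
    have "\<bar>t\<^sup>2 * p' (0, 1) - t\<^sup>2 * q' (1, 0)\<bar> \<le> 2 * e * t\<^sup>2"
      using d1(2)[OF t(1,2)] d2(2)[OF t(1,3)] by linarith
    then have "t\<^sup>2 * \<bar>p' (0, 1) - q' (1, 0)\<bar> \<le> t\<^sup>2 * (2 * e)"
      by (metis (no_types, lifting) abs_mult abs_of_nonneg mult.commute right_diff_distrib zero_le_power2)
    then show ?thesis using t(1) by (simp add: mult_le_cancel_left)
  qed
  from this[of "\<bar>p' (0, 1) - q' (1, 0)\<bar> / 4"] show ?thesis by auto
qed

text \<open>A factor that is merely continuous does not spoil differentiability at a zero of the other factor.\<close>

lemma has_derivative_mult_vanishing:
  fixes f a :: "'a::real_normed_vector \<Rightarrow> real"
  assumes f: "(f has_derivative f') (at z)" and f0: "f z = 0" and a: "isCont a z"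
  shows "((\<lambda>w. f w * a w) has_derivative (\<lambda>h. f' h * a z)) (at z)"
proof -
  have lin: "bounded_linear f'" using f has_derivative_bounded_linear by blast
  have 1: "((\<lambda>w. f w * a z) has_derivative (\<lambda>h. f' h * a z)) (at z)"
    using f by (rule has_derivative_mult_left)
  have "((\<lambda>w. f w * (a w - a z)) has_derivative (\<lambda>h. 0)) (at z)"
  proof -
    obtain B where B: "B > 0" "\<forall>\<^sub>F w in at z. norm (f w) \<le> B * norm (w - z)"
    proof -
      obtain K where K: "K > 0" "\<And>h. norm (f' h) \<le> norm h * K"
        using bounded_linear.pos_bounded[OF lin] by blast
      from f[unfolded has_derivative_at_alt] obtain d where d: "d > 0"
        "\<And>w. norm (w - z) < d \<Longrightarrow> norm (f w - f z - f' (w - z)) \<le> 1 * norm (w - z)"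
        by (metis zero_less_one)
      have "norm (f w) \<le> (K + 1) * norm (w - z)" if "norm (w - z) < d" for w
        using d(2)[OF that] K(2)[of "w - z"] f0 by (simp add: algebra_simps)
      then have "\<forall>\<^sub>F w in at z. norm (f w) \<le> (K + 1) * norm (w - z)"
        using d(1) by (auto simp: eventually_at dist_norm)
      then show ?thesis using K(1) that[of "K + 1"] by simp
    qed
    have lim: "((\<lambda>w. B * \<bar>a w - a z\<bar>) \<longlongrightarrow> 0) (at z)"
      using a unfolding isCont_def by (auto intro!: tendsto_eq_intros)
    have "((\<lambda>w. (f w * (a w - a z)) /\<^sub>R norm (w - z)) \<longlongrightarrow> 0) (at z)"
    proof (rule Lim_null_comparison[OF _ lim])
      show "\<forall>\<^sub>F w in at z. norm ((f w * (a w - a z)) /\<^sub>R norm (w - z)) \<le> B * \<bar>a w - a z\<bar>"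
        using B(2)
      proof (eventually_elim)
        case (elim w)
        show ?case
        proof (cases "w = z")
          case False
          then have "\<bar>f w\<bar> / norm (w - z) \<le> B" using elim by (simp add: divide_simps)
          then have "\<bar>f w\<bar> / norm (w - z) * \<bar>a w - a z\<bar> \<le> B * \<bar>a w - a z\<bar>" by (intro mult_right_mono) auto
          then show ?thesis by (simp add: abs_mult divide_simps)
        qed (use B(1) in auto)
      qed
    qed
    then show ?thesis unfolding has_derivative_at_within by (auto simp: f0)
  qed
  from has_derivative_add[OF 1 this] show ?thesis by (simp add: algebra_simps)
qed

text \<open>With \<open>F\<close> of class \<open>C\<^sup>1\<close>, the form \<open>dS = F\<^sub>2 dF\<^sub>1 - y dx\<close> is only continuous.  Subtracting
  \<open>c dF\<^sub>1\<close> with \<open>c = F\<^sub>2(z\<^sub>0)\<close> replaces \<open>F\<^sub>2\<close> by a function that vanishes at \<open>z\<^sub>0\<close>; by the preceding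
  lemma the coefficients then are differentiable at \<open>z\<^sub>0\<close>, and equality of the mixed derivatives
  reads \<open>det DF(z\<^sub>0) = 1\<close>.\<close>

lemma det_eq_1_of_exact:
  fixes F :: "real \<times> real \<Rightarrow> real \<times> real" and F' :: "real \<times> real \<Rightarrow> (real \<times> real) \<Rightarrow>\<^sub>L (real \<times> real)"
  assumes W: "open W" "z0 \<in> W"
    and F: "\<And>z. z \<in> W \<Longrightarrow> (F has_derivative blinfun_apply (F' z)) (at z)"
    and cont: "continuous_on W F'"
    and s: "\<And>z. z \<in> W \<Longrightarrow> (s has_derivative (\<lambda>h. snd (F z) * fst (F' z h) - snd z * fst h)) (at z)"
  shows "fst (F' z0 (1, 0)) * snd (F' z0 (0, 1)) - fst (F' z0 (0, 1)) * snd (F' z0 (1, 0)) = 1"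
proof -
  define c where "c = snd (F z0)"
  define a where "a z = fst (F' z (1, 0))" for z
  define b where "b z = fst (F' z (0, 1))" for z
  have ab: "fst (F' z h) = a z * fst h + b z * snd h" for z h
  proof -
    have "h = fst h *\<^sub>R (1, 0) + snd h *\<^sub>R (0, 1)" by (simp add: prod_eq_iff)
    then have "F' z h = fst h *\<^sub>R F' z (1, 0) + snd h *\<^sub>R F' z (0, 1)"
      by (metis blinfun.add_right blinfun.scaleR_right)
    then show ?thesis by (simp add: a_def b_def)
  qed
  have isF': "isCont F' z0" using cont W continuous_on_eq_continuous_at by blast
  have "isCont a z0" "isCont b z0"
    unfolding a_def b_def by (intro continuous_intros isF')+
  define g where "g z = s z - c * fst (F z) + snd z0 * fst z" for z
  define p where "p z = (snd (F z) - c) * a z - (snd z - snd z0)" for z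
  define q where "q z = (snd (F z) - c) * b z" for z
  have g: "(g has_derivative (\<lambda>h. p z * fst h + q z * snd h)) (at z)" if z: "z \<in> W" for z
  proof -
    have "(g has_derivative (\<lambda>h. (snd (F z) * fst (F' z h) - snd z * fst h) - c * fst (F' z h) + snd z0 * fst h)) (at z)"
      unfolding g_def
      by (intro has_derivative_add has_derivative_diff has_derivative_mult_right s[OF z]
            has_derivative_fst F[OF z] has_derivative_ident)
    then show ?thesis
      by (rule has_derivative_eq_rhs) (auto simp: ab p_def q_def algebra_simps)
  qed
  have F2: "((\<lambda>z. snd (F z) - c) has_derivative (\<lambda>h. snd (F' z0 h))) (at z0)"
    using has_derivative_diff[OF has_derivative_snd[OF F[OF W(2)]] has_derivative_const[of c]] by simp
  have q: "(q has_derivative (\<lambda>h. snd (F' z0 h) * b z0)) (at z0)"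
    unfolding q_def by (rule has_derivative_mult_vanishing[OF F2]) (auto simp: c_def \<open>isCont b z0\<close>)
  have "((\<lambda>z. (snd (F z) - c) * a z) has_derivative (\<lambda>h. snd (F' z0 h) * a z0)) (at z0)"
    by (rule has_derivative_mult_vanishing[OF F2]) (auto simp: c_def \<open>isCont a z0\<close>)
  then have p: "(p has_derivative (\<lambda>h. snd (F' z0 h) * a z0 - (snd h - 0))) (at z0)"
    unfolding p_def
    by (intro has_derivative_diff has_derivative_snd has_derivative_ident has_derivative_const)
  show ?thesis
    using mixed_partials_eq[OF W g p q] by (simp add: a_def b_def algebra_simps)
qed

section \<open>Area under uniform limits\<close>

text \<open>Determinants and the change of variables formula belong to \<open>real^'n\<close>; \<open>to_pair\<close> and \<open>of_pair\<close>
  transport them to \<open>real \<times> real\<close>.\<close>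

definition to_pair :: "real^2 \<Rightarrow> real \<times> real" where "to_pair v = (v $ 1, v $ 2)"
definition of_pair :: "real \<times> real \<Rightarrow> real^2" where "of_pair z = vector [fst z, snd z]"

lemma to_of_pair [simp]: "to_pair (of_pair z) = z"
  by (simp add: to_pair_def of_pair_def)
lemma of_to_pair [simp]: "of_pair (to_pair v) = v"
  by (simp add: to_pair_def of_pair_def vec_eq_iff forall_2)

lemma bounded_linear_to_pair: "bounded_linear to_pair"
  unfolding to_pair_def[abs_def] by (intro bounded_linear_Pair bounded_linear_vec_nth)

lemma bounded_linear_of_pair: "bounded_linear of_pair"
proof -
  have "linear of_pair"
    by (auto simp: of_pair_def linear_iff vec_eq_iff forall_2)
  then show ?thesis by (simp add: linear_conv_bounded_linear)
qed

lemma vimage_to_pair: "to_pair -` A = of_pair ` A"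
proof
  show "to_pair -` A \<subseteq> of_pair ` A" by (metis image_eqI of_to_pair subsetI vimageE)
  show "of_pair ` A \<subseteq> to_pair -` A" by auto
qed

lemma distr_to_pair: "distr lborel borel to_pair = lborel"
proof (rule sym, rule lborel_eqI)
  have m: "to_pair \<in> borel_measurable borel"
    by (intro borel_measurable_continuous_onI linear_continuous_on bounded_linear_to_pair)
  fix l u :: "real \<times> real" assume lu: "\<And>b. b \<in> Basis \<Longrightarrow> l \<bullet> b \<le> u \<bullet> b"
  have lu': "fst l \<le> fst u" "snd l \<le> snd u"
    using lu[of "(1, 0)"] lu[of "(0, 1)"] by (auto simp: Basis_prod_def inner_prod_def)
  have B: "Basis = {axis 1 1, axis 2 1 :: real^2}"
    by (auto simp: Basis_vec_def UNIV_2)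
  have "to_pair -` box l u = box (of_pair l) (of_pair u)"
    by (auto simp: box_def B inner_axis Basis_prod_def inner_prod_def to_pair_def of_pair_def)
  then have "emeasure (distr lborel borel to_pair) (box l u) = emeasure lborel (box (of_pair l) (of_pair u))"
    using m by (subst emeasure_distr) auto
  also have "\<dots> = (\<Prod>b\<in>Basis. (of_pair u - of_pair l) \<bullet> b)"
    by (rule emeasure_lborel_box) (use lu' in \<open>auto simp: B inner_axis of_pair_def\<close>)
  also have "\<dots> = (fst u - fst l) * (snd u - snd l)"
    unfolding B by (simp add: inner_axis of_pair_def axis_eq_axis)
  also have "\<dots> = (\<Prod>b\<in>Basis. (u - l) \<bullet> b)"
    by (simp add: Basis_prod_def prod.union_disjoint inner_prod_def mult.commute)
  finally show "emeasure (distr lborel borel to_pair) (box l u) = (\<Prod>b\<in>Basis. (u - l) \<bullet> b)" .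
qed simp

lemma emeasure_of_pair_image:
  assumes "compact K"
  shows "emeasure lborel (of_pair ` K) = emeasure lborel K"
proof -
  have m: "to_pair \<in> borel_measurable borel"
    by (intro borel_measurable_continuous_onI linear_continuous_on bounded_linear_to_pair)
  have "emeasure lborel K = emeasure (distr lborel borel to_pair) K" by (simp add: distr_to_pair)
  also have "\<dots> = emeasure lborel (to_pair -` K)"
    using m assms by (subst emeasure_distr) (auto simp: borel_compact)
  finally show ?thesis by (simp add: vimage_to_pair)
qed

lemma emeasure_image_unit_det:
  fixes F :: "real \<times> real \<Rightarrow> real \<times> real"
  assumes K: "compact K" and inj: "inj_on F K"
    and F: "\<And>z. z \<in> K \<Longrightarrow> (F has_derivative F' z) (at z)"
    and det: "\<And>z. z \<in> K \<Longrightarrow> \<bar>fst (F' z (1, 0)) * snd (F' z (0, 1)) - fst (F' z (0, 1)) * snd (F' z (1, 0))\<bar> = 1"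
  shows "emeasure lborel (F ` K) = emeasure lborel K"
proof -
  define f where "f = (\<lambda>v. of_pair (F (to_pair v)))"
  define f' where "f' v = (\<lambda>h. of_pair (F' (to_pair v) (to_pair h)))" for v
  have cont_of: "continuous_on A of_pair" for A
    by (intro linear_continuous_on bounded_linear_of_pair)
  have cK: "compact (of_pair ` K)" using K cont_of compact_continuous_image by blast
  have contF: "continuous_on K F"
    using F by (meson continuous_at_imp_continuous_on has_derivative_continuous)
  have cFK: "compact (F ` K)" using K contF compact_continuous_image by blast
  have cFK': "compact (of_pair ` F ` K)" using cFK cont_of compact_continuous_image by blast
  have der: "(f has_derivative f' v) (at v within of_pair ` K)" if "v \<in> of_pair ` K" for v
  proof -
    have "((\<lambda>v. F (to_pair v)) has_derivative (\<lambda>h. F' (to_pair v) (to_pair h))) (at v)"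
      by (rule has_derivative_compose[OF bounded_linear_imp_has_derivative[OF bounded_linear_to_pair]])
         (use that F in auto)
    then have "(f has_derivative f' v) (at v)" unfolding f_def f'_def
      by (rule bounded_linear.has_derivative[OF bounded_linear_of_pair])
    then show ?thesis by (rule has_derivative_at_withinI)
  qed
  have inj': "inj_on f (of_pair ` K)"
  proof -
    have "inj of_pair" by (metis injI to_of_pair)
    then show ?thesis using inj unfolding inj_on_def f_def by (metis imageE to_of_pair)
  qed
  have d1: "\<bar>det (matrix (f' v))\<bar> = 1" if "v \<in> of_pair ` K" for v
  proof -
    have "to_pair v \<in> K" using that by auto
    from det[OF this] show ?thesis
      by (simp add: det_2 matrix_def f'_def to_pair_def of_pair_def axis_def)
  qed
  have lm: "of_pair ` K \<in> lmeasurable" using cK lmeasurable_compact by blast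
  have int1: "(\<lambda>v. \<bar>det (matrix (f' v))\<bar>) integrable_on of_pair ` K"
    using lm d1 by (simp add: integrable_on_const cong: integrable_cong)
  have "measure lebesgue (f ` of_pair ` K) = integral (of_pair ` K) (\<lambda>v. \<bar>det (matrix (f' v))\<bar>)"
    by (rule measure_differentiable_image_eq[OF _ der inj' int1]) (use lm in auto)
  also have "\<dots> = integral (of_pair ` K) (\<lambda>v. 1)" using d1 by (intro integral_cong) auto
  also have "\<dots> = measure lebesgue (of_pair ` K)" using lm by (simp add: lmeasure_integral)
  finally have "measure lebesgue (of_pair ` F ` K) = measure lebesgue (of_pair ` K)"
    by (simp add: f_def image_image)
  then have "measure lborel (of_pair ` F ` K) = measure lborel (of_pair ` K)"
    using cK cFK' by (simp add: measure_completion borel_compact)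
  then have "emeasure lborel (of_pair ` F ` K) = emeasure lborel (of_pair ` K)"
    using emeasure_compact_finite[OF cK] emeasure_compact_finite[OF cFK']
    by (simp add: emeasure_eq_ennreal_measure)
  then show ?thesis by (simp add: emeasure_of_pair_image K cFK)
qed

text \<open>Finitely many pieces of \<open>K\<close> on which \<open>f\<close> oscillates by less than \<open>e / 2\<close> give finitely many
  subbasic neighbourhoods of \<open>f\<close> whose intersection forces uniform closeness.\<close>

lemma uniformly_close_of_compact_open:
  fixes f :: "'a::metric_space \<Rightarrow> 'b::metric_space"
  assumes K: "compact K" and f: "continuous_on K f" and e: "e > 0"
    and conv: "\<And>C G. compact C \<Longrightarrow> C \<subseteq> K \<Longrightarrow> open G \<Longrightarrow> f ` C \<subseteq> G \<Longrightarrow> \<forall>\<^sub>F n in F. fs n ` C \<subseteq> G"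
  shows "\<forall>\<^sub>F n in F. \<forall>x\<in>K. dist (fs n x) (f x) < e"
proof -
  have "uniformly_continuous_on K f" using f K compact_uniformly_continuous by blast
  then obtain d where d: "d > 0" "\<And>x y. x \<in> K \<Longrightarrow> y \<in> K \<Longrightarrow> dist y x < d \<Longrightarrow> dist (f y) (f x) < e/2"
    unfolding uniformly_continuous_on_def using e by (meson half_gt_zero)
  have "K \<subseteq> (\<Union>x\<in>K. ball x (d/2))" using d(1) by auto
  then obtain X where X: "X \<subseteq> K" "finite X" "K \<subseteq> (\<Union>x\<in>X. ball x (d/2))"
    by (rule compactE_image[OF K, rotated]) auto
  have "\<forall>\<^sub>F n in F. fs n ` (K \<inter> cball x (d/2)) \<subseteq> ball (f x) (e/2)" if "x \<in> X" for x
  proof (rule conv)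
    show "compact (K \<inter> cball x (d/2))" using K by (simp add: compact_Int_closed)
    show "f ` (K \<inter> cball x (d/2)) \<subseteq> ball (f x) (e/2)"
      using d X(1) that by (fastforce simp: dist_commute)
  qed auto
  then have "\<forall>\<^sub>F n in F. \<forall>x\<in>X. fs n ` (K \<inter> cball x (d/2)) \<subseteq> ball (f x) (e/2)"
    using X(2) by (simp add: eventually_ball_finite)
  then show ?thesis
  proof eventually_elim
    case (elim n)
    show ?case
    proof
      fix y assume y: "y \<in> K"
      then obtain x where x: "x \<in> X" "dist x y < d/2" using X(3) by auto
      then have "dist (f x) (fs n y) < e/2" using elim y by fastforce
      moreover have "dist (f y) (f x) < e/2" using d(2)[of x y] x X(1) y d(1) by (auto simp: dist_commute)
      ultimately show "dist (fs n y) (f y) < e"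
        using dist_triangle_half_r by (metis dist_commute)
    qed
  qed
qed

text \<open>A continuous map that moves points by at most \<open>r\<close> cannot miss a point at depth \<open>r\<close>:
  \<open>x \<mapsto> y + (x - G x)\<close> maps the ball of radius \<open>r\<close> about \<open>y\<close> to itself, and a fixed point is a
  preimage of \<open>y\<close>.\<close>

lemma ball_subset_image_of_close:
  fixes G :: "'a::euclidean_space \<Rightarrow> 'a"
  assumes G: "continuous_on D G" and r: "r > 0" and sub: "cball y r \<subseteq> D"
    and close: "\<And>x. x \<in> D \<Longrightarrow> dist (G x) x \<le> r"
  shows "y \<in> G ` D"
proof -
  have "\<exists>x\<in>cball y r. G x = y"
  proof (rule brouwer_surjective_cball[where S="{y}"])
    show "continuous_on (cball y r) G" using G sub continuous_on_subset by blast
    fix x w assume "x \<in> {y}" "w \<in> cball y r"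
    then have "x = y" "dist (G w) w \<le> r" using close[of w] sub by auto
    then show "x + (w - G w) \<in> cball y r"
      by (simp add: dist_norm norm_minus_commute)
  qed (use r in auto)
  then show ?thesis using sub by blast
qed

text \<open>The interior of \<open>D\<close> is the increasing union of the sets of points at depth \<open>1 / (m + 1)\<close>.\<close>

lemma emeasure_interior_le:
  fixes D :: "'a::euclidean_space set"
  assumes "\<And>r. r > 0 \<Longrightarrow> emeasure lborel {y. ball y r \<subseteq> D} \<le> M"
  shows "emeasure lborel (interior D) \<le> M"
proof -
  define I where "I m = {y. ball y (1 / real (Suc m)) \<subseteq> D}" for m
  have cl: "closed {y. ball y r \<subseteq> D}" for r
  proof -
    have "- {y. ball y r \<subseteq> D} = (\<Union>x\<in>-D. ball x r)" by (auto simp: dist_commute)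
    then show ?thesis by (metis closed_def open_UN open_ball)
  qed
  have "incseq I"
  proof (rule incseq_SucI, rule subsetI)
    fix m y assume "y \<in> I m"
    moreover have "ball y (1 / real (Suc (Suc m))) \<subseteq> ball y (1 / real (Suc m))"
      by (rule subset_ball) (simp add: divide_simps)
    ultimately show "y \<in> I (Suc m)" unfolding I_def by blast
  qed
  moreover have "range I \<subseteq> sets lborel" unfolding I_def using cl by (auto simp: borel_closed)
  ultimately have "(SUP m. emeasure lborel (I m)) = emeasure lborel (\<Union>m. I m)"
    by (intro SUP_emeasure_incseq) auto
  moreover have "interior D \<subseteq> (\<Union>m. I m)"
  proof
    fix y assume "y \<in> interior D"
    then obtain e where e: "e > 0" "ball y e \<subseteq> D" by (meson mem_interior)
    then obtain m where "1 / real (Suc m) < e" by (meson nat_approx_posE)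
    then have "ball y (1 / real (Suc m)) \<subseteq> ball y e" by (intro subset_ball) auto
    then show "y \<in> (\<Union>m. I m)" using e by (auto simp: I_def)
  qed
  moreover have "(\<Union>m. I m) \<in> sets lborel"
    unfolding I_def using cl by (auto simp: borel_closed)
  ultimately have "emeasure lborel (interior D) \<le> (SUP m. emeasure lborel (I m))"
    by (metis emeasure_mono)
  also have "\<dots> \<le> M" unfolding I_def by (intro SUP_least assms) auto
  finally show ?thesis .
qed

text \<open>For the first inequality, \<open>fs n ` K\<close> ends up in each open set around \<open>f ` K\<close>.
  For the second, \<open>fs n \<circ> f\<^sup>-\<^sup>1\<close> is close to the identity on \<open>f ` K\<close>, so
  \<open>fs n ` K\<close> contains all points of \<open>f ` K\<close> at a given depth once \<open>n\<close> is large; this is where injectivity of \<open>f\<close>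
  enters.  Together they give equality for sets \<open>K\<close> whose image has a negligible frontier.\<close>

lemma area_comparison_in_limit:
  fixes f :: "'a::euclidean_space \<Rightarrow> 'a"
  assumes K: "compact K" and f: "continuous_on K f" "inj_on f K"
    and fs: "\<forall>\<^sub>F n in sequentially. continuous_on K (fs n) \<and> emeasure lborel (fs n ` K) = emeasure lborel K"
    and conv: "\<And>C G. compact C \<Longrightarrow> C \<subseteq> K \<Longrightarrow> open G \<Longrightarrow> f ` C \<subseteq> G \<Longrightarrow> \<forall>\<^sub>F n in sequentially. fs n ` C \<subseteq> G"
  shows "emeasure lborel K \<le> emeasure lborel (f ` K)"
    and "emeasure lborel (interior (f ` K)) \<le> emeasure lborel K"
proof -
  have cfK: "compact (f ` K)" using K f compact_continuous_image by blast
  show "emeasure lborel K \<le> emeasure lborel (f ` K)"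
  proof (rule ennreal_le_epsilon)
    fix e :: real assume e: "0 < e"
    have b: "f ` K \<in> sets borel" using cfK borel_compact by blast
    then obtain G where G: "open G" "f ` K \<subseteq> G" "emeasure lborel (G - f ` K) < ennreal e"
      using outer_regular_lborel[of "f ` K" e] b e by auto
    have "\<forall>\<^sub>F n in sequentially. fs n ` K \<subseteq> G" using conv[OF K _ G(1,2)] by auto
    with fs have "\<forall>\<^sub>F n in sequentially. emeasure lborel K \<le> emeasure lborel G"
      by eventually_elim (metis G(1) borel_open emeasure_mono sets_lborel)
    then have "emeasure lborel K \<le> emeasure lborel G" by simp
    also have "\<dots> \<le> emeasure lborel (f ` K) + emeasure lborel (G - f ` K)"
      using emeasure_subadditive[of "f ` K" lborel "G - f ` K"] b G by (simp add: Un_absorb1)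
    also have "\<dots> \<le> emeasure lborel (f ` K) + ennreal e"
      using G(3) by (intro add_left_mono) auto
    finally show "emeasure lborel K \<le> emeasure lborel (f ` K) + ennreal e" .
  qed
  show "emeasure lborel (interior (f ` K)) \<le> emeasure lborel K"
  proof (rule emeasure_interior_le)
    fix r :: real assume r: "r > 0"
    let ?g = "inv_into K f"
    have g: "continuous_on (f ` K) ?g" by (rule continuous_on_inv[OF f(1) K]) (use f(2) in auto)
    have "\<forall>\<^sub>F n in sequentially. \<forall>x\<in>K. dist (fs n x) (f x) < r / 2"
      using uniformly_close_of_compact_open[OF K f(1) _ conv, of "r / 2"] r by simp
    with fs have "\<forall>\<^sub>F n in sequentially. emeasure lborel {y. ball y r \<subseteq> f ` K} \<le> emeasure lborel K"
    proof eventually_elim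
      case (elim n)
      have "{y. ball y r \<subseteq> f ` K} \<subseteq> fs n ` K"
      proof
        fix y assume "y \<in> {y. ball y r \<subseteq> f ` K}"
        then have "cball y (r/2) \<subseteq> f ` K" using r by auto
        then have "y \<in> (\<lambda>w. fs n (?g w)) ` f ` K"
        proof (rule ball_subset_image_of_close[rotated 2])
          show "continuous_on (f ` K) (\<lambda>w. fs n (?g w))"
            by (rule continuous_on_compose2[OF _ g]) (use elim in \<open>auto simp: inv_into_into\<close>)
          fix x assume "x \<in> f ` K"
          then show "dist (fs n (?g x)) x \<le> r/2" using elim f(2) by auto
        qed (use r in auto)
        then show "y \<in> fs n ` K" using f(2) by auto
      qed
      moreover have "compact (fs n ` K)" using elim K compact_continuous_image by blast
      ultimately show ?case using elim by (metis borel_compact emeasure_mono sets_lborel)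
    qed
    then show "emeasure lborel {y. ball y r \<subseteq> f ` K} \<le> emeasure lborel K" by simp
  qed
qed

section \<open>Slicing, and an elimination argument\<close>

lemma sets_lborel_pair: "sets (lborel \<Otimes>\<^sub>M lborel) = sets (borel :: (real \<times> real) measure)"
  by (simp only: lborel_prod sets_lborel)

text \<open>The slices over the end points are left out so that the same statement measures a closed strip
  and the open strip inside it.\<close>

lemma emeasure_eq_by_vertical_slices:
  fixes S :: "(real \<times> real) set"
  assumes S: "S \<in> sets borel" and ab: "a \<le> b"
    and slices: "\<And>x. x \<noteq> a \<Longrightarrow> x \<noteq> b \<Longrightarrow> emeasure lborel {y. (x, y) \<in> S} = ennreal (f x) * indicator {a..b} x"
    and f: "f \<in> borel_measurable borel" "\<And>x. x \<in> {a..b} \<Longrightarrow> 0 \<le> f x"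
    and F: "\<And>x. x \<in> {a..b} \<Longrightarrow> (F has_real_derivative f x) (at x)"
  shows "emeasure lborel S = ennreal (F b - F a)"
proof -
  have "emeasure lborel S = emeasure (lborel \<Otimes>\<^sub>M lborel) S" by (simp add: lborel_prod)
  also have "\<dots> = (\<integral>\<^sup>+x. emeasure lborel {y. (x, y) \<in> S} \<partial>lborel)"
    using lborel.emeasure_pair_measure_alt[of S lborel] S by (simp only: sets_lborel_pair vimage_def)
  also have "\<dots> = (\<integral>\<^sup>+x. ennreal (f x) * indicator {a..b} x \<partial>lborel)"
  proof (rule nn_integral_cong_AE)
    show "AE x in lborel. emeasure lborel {y. (x, y) \<in> S} = ennreal (f x) * indicator {a..b} x"
      using AE_lborel_singleton[of a] AE_lborel_singleton[of b] by eventually_elim (rule slices)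
  qed
  also have "\<dots> = ennreal (F b - F a)"
    using f F ab by (intro nn_integral_FTC_Icc) (auto simp: has_real_derivative_iff_has_vector_derivative intro: has_vector_derivative_at_within)
  finally show ?thesis .
qed

lemma emeasure_between_by_horizontal_slices:
  fixes S :: "(real \<times> real) set"
  assumes S: "S \<in> sets borel" and uv: "u \<le> v" and m: "0 \<le> m" "0 \<le> M"
    and inside: "\<And>y. y \<in> {u..v} \<Longrightarrow> ennreal m \<le> emeasure lborel {x. (x, y) \<in> S} \<and> emeasure lborel {x. (x, y) \<in> S} \<le> ennreal M"
    and outside: "\<And>y. y \<notin> {u..v} \<Longrightarrow> {x. (x, y) \<in> S} = {}"
  shows "ennreal (m * (v - u)) \<le> emeasure lborel S" "emeasure lborel S \<le> ennreal (M * (v - u))"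
proof -
  have const: "(\<integral>\<^sup>+y. ennreal c * indicator {u..v} y \<partial>lborel) = ennreal (c * (v - u))" if "0 \<le> c" for c
    using that uv by (simp add: nn_integral_cmult_indicator ennreal_mult)
  have "emeasure lborel S = emeasure (lborel \<Otimes>\<^sub>M lborel) S" by (simp add: lborel_prod)
  also have "\<dots> = (\<integral>\<^sup>+y. emeasure lborel {x. (x, y) \<in> S} \<partial>lborel)"
    using lborel_pair.emeasure_pair_measure_alt2[of S] S by (simp only: sets_lborel_pair vimage_def)
  finally have eq: "emeasure lborel S = (\<integral>\<^sup>+y. emeasure lborel {x. (x, y) \<in> S} \<partial>lborel)" .
  show "ennreal (m * (v - u)) \<le> emeasure lborel S"
    unfolding eq const[OF m(1), symmetric]
    by (intro nn_integral_mono) (auto simp: inside indicator_def)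
  show "emeasure lborel S \<le> ennreal (M * (v - u))"
    unfolding eq const[OF m(2), symmetric]
    by (intro nn_integral_mono) (use inside outside in \<open>auto simp: indicator_def\<close>)
qed

text \<open>A nonconstant Moebius function of \<open>p\<close> that converges forces \<open>p\<close> to converge.  If the limit \<open>\<rho>\<close>
  happened to be the value \<open>s' / s\<close> of the Moebius function at infinity, boundedness of \<open>p\<close> would
  give \<open>L' = \<rho> L\<close>, against the determinant condition.\<close>

lemma convergent_of_moebius_convergent:
  fixes p :: "'a \<Rightarrow> real"
  assumes nt: "G \<noteq> bot"
    and bound: "\<forall>\<^sub>F x in G. \<bar>p x\<bar> \<le> B"
    and nz: "\<forall>\<^sub>F x in G. L + p x * s \<noteq> 0"
    and lim: "((\<lambda>x. (L' + p x * s') / (L + p x * s)) \<longlongrightarrow> \<rho>) G"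
    and det: "L * s' \<noteq> L' * s"
  shows "\<exists>D. (p \<longlongrightarrow> D) G"
proof -
  \<comment> \<open>Clearing the bounded denominator leaves an affine function of \<open>p\<close> that tends to \<open>0\<close>.\<close>
  have "((\<lambda>x. (L' + p x * s') / (L + p x * s) - \<rho>) \<longlongrightarrow> 0) G"
    using lim by (simp add: LIM_zero)
  moreover have "\<forall>\<^sub>F x in G. norm (L + p x * s) \<le> \<bar>L\<bar> + B * \<bar>s\<bar>"
    using bound
  proof eventually_elim
    case (elim x)
    have "\<bar>L + p x * s\<bar> \<le> \<bar>L\<bar> + \<bar>p x\<bar> * \<bar>s\<bar>" by (metis abs_mult abs_triangle_ineq)
    also have "\<dots> \<le> \<bar>L\<bar> + B * \<bar>s\<bar>" using elim by (simp add: mult_right_mono)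
    finally show ?case by simp
  qed
  then have "Bfun (\<lambda>x. L + p x * s) G" by (rule BfunI)
  ultimately have "((\<lambda>x. ((L' + p x * s') / (L + p x * s) - \<rho>) * (L + p x * s)) \<longlongrightarrow> 0) G"
    by (simp add: tendsto_Zfun_iff bounded_bilinear.Zfun_prod_Bfun[OF bounded_bilinear_mult])
  moreover have "\<forall>\<^sub>F x in G. ((L' + p x * s') / (L + p x * s) - \<rho>) * (L + p x * s)
      = (L' - \<rho> * L) + (s' - \<rho> * s) * p x"
    using nz by eventually_elim (simp add: field_simps)
  ultimately have *: "((\<lambda>x. (L' - \<rho> * L) + (s' - \<rho> * s) * p x) \<longlongrightarrow> 0) G"
    using tendsto_cong by fast
  show ?thesis
  proof (cases "s' - \<rho> * s = 0")
    case True
    then have "L' - \<rho> * L = 0" using * nt by (simp add: tendsto_const_iff)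
    with True have "L * s' = L' * s" by (simp add: algebra_simps)
    with det show ?thesis by simp
  next
    case False
    have "((\<lambda>x. (((L' - \<rho> * L) + (s' - \<rho> * s) * p x) - (L' - \<rho> * L)) / (s' - \<rho> * s)) \<longlongrightarrow> (0 - (L' - \<rho> * L)) / (s' - \<rho> * s)) G"
      using False by (intro tendsto_intros *)
    then show ?thesis using False by auto
  qed
qed

text \<open>Around a point \<open>m\<close> with \<open>sin 2\<pi>m \<noteq> 0\<close> the sine has nonzero second differences:
  \<open>sin 2\<pi>(m + t) + sin 2\<pi>(m - t) = 2 sin(2\<pi>m) cos(2\<pi>t)\<close>.\<close>

lemma exists_noncollinear_sine_points:
  fixes x0 d :: real
  assumes "d > 0"
  obtains a b b' where "x0 - d \<le> a" "a < b" "a < b'" "b \<le> x0 + d" "b' \<le> x0 + d"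
    "(b - a) * (sin (2 * pi * b') - sin (2 * pi * a)) \<noteq> (b' - a) * (sin (2 * pi * b) - sin (2 * pi * a))"
proof -
  define t where "t = min (d / 2) (1 / 4)"
  have t: "0 < t" "t \<le> d / 2" "t \<le> 1 / 4" using assms by (auto simp: t_def)
  have st: "sin (2 * pi * t) > 0" by (rule sin_gt_zero) (use t in auto)
  have "2 * pi * t \<le> 2 * pi * (1 / 4)" using t by (intro mult_left_mono) auto
  then have t2: "0 < 2 * pi * t" "2 * pi * t \<le> pi" using t by (auto intro: order_trans)
  have ct: "cos (2 * pi * t) \<noteq> 1" using cos_monotone_0_pi[of 0 "2 * pi * t"] t2 by simp
  obtain m where m: "x0 \<le> m" "m \<le> x0 + d / 2" "sin (2 * pi * m) \<noteq> 0"
  proof (cases "sin (2 * pi * x0) = 0")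
    case True
    then have "cos (2 * pi * x0) \<noteq> 0" using sin_zero_abs_cos_one by fastforce
    then have "sin (2 * pi * (x0 + t)) \<noteq> 0" using st True by (simp add: distrib_left sin_add)
    then show ?thesis using that[of "x0 + t"] t by auto
  next
    case False
    then show ?thesis using that[of x0] assms by auto
  qed
  show thesis
  proof (rule that[of "m - t" m "m + t"])
    have "sin (2 * pi * (m + t)) + sin (2 * pi * (m - t)) = 2 * sin (2 * pi * m) * cos (2 * pi * t)"
      by (simp add: distrib_left right_diff_distrib sin_add sin_diff)
    also have "\<dots> \<noteq> 2 * sin (2 * pi * m)" using m(3) ct by simp
    finally have ne: "sin (2 * pi * (m + t)) + sin (2 * pi * (m - t)) \<noteq> 2 * sin (2 * pi * m)" .
    show "(m - (m - t)) * (sin (2 * pi * (m + t)) - sin (2 * pi * (m - t))) \<noteq>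
        (m + t - (m - t)) * (sin (2 * pi * m) - sin (2 * pi * (m - t)))"
    proof
      assume "(m - (m - t)) * (sin (2 * pi * (m + t)) - sin (2 * pi * (m - t))) =
        (m + t - (m - t)) * (sin (2 * pi * m) - sin (2 * pi * (m - t)))"
      then have "t * (sin (2 * pi * (m + t)) - sin (2 * pi * (m - t))) =
        t * (2 * (sin (2 * pi * m) - sin (2 * pi * (m - t))))" by simp
      then have "sin (2 * pi * (m + t)) - sin (2 * pi * (m - t)) =
        2 * (sin (2 * pi * m) - sin (2 * pi * (m - t)))" using t(1) by (simp only: mult_cancel_left) simp
      with ne show False by argo
    qed
  qed (use m t in auto)
qed

section \<open>Straightening in the plane\<close>

text \<open>In these coordinates of the plane the lifted leaves are the horizontal lines.\<close>

definition leaf_chart :: "(real \<Rightarrow> real) \<Rightarrow> real \<times> real \<Rightarrow> real \<times> real" where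
  "leaf_chart \<epsilon> z = (fst z, snd z + \<epsilon> (snd z) * cos (2 * pi * fst z))"

abbreviation pair_quotient :: "(real \<Rightarrow> real) \<Rightarrow> real \<times> real \<Rightarrow> real" where
  "pair_quotient \<epsilon> q \<equiv> (\<epsilon> (snd q) - \<epsilon> (fst q)) / (snd q - fst q)"

text \<open>Convergence of \<open>pair_quotient\<close> along this filter is strict differentiability at \<open>k\<close>: both
  arguments of the difference quotient move.\<close>

abbreviation at_diagonal :: "real \<Rightarrow> (real \<times> real) filter" where
  "at_diagonal k \<equiv> at (k, k) within {q. fst q < snd q}"

lemma at_diagonal_neq_bot: "at_diagonal k \<noteq> bot"
proof -
  have "(k, k) islimpt {q. fst q < snd q}"
    unfolding islimpt_approachable
  proof safe
    fix e :: real assume "e > 0"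
    then show "\<exists>x'\<in>{q. fst q < snd q}. x' \<noteq> (k, k) \<and> dist x' (k, k) < e"
      by (intro bexI[of _ "(k, k + e / 2)"]) (auto simp: dist_prod_def dist_real_def)
  qed
  then show ?thesis by (simp add: trivial_limit_within)
qed

lemma eventually_at_diagonal:
  assumes "d > 0"
    and "\<And>k1 k2. k1 < k2 \<Longrightarrow> \<bar>k1 - k\<bar> < d \<Longrightarrow> \<bar>k2 - k\<bar> < d \<Longrightarrow> P (k1, k2)"
  shows "eventually P (at_diagonal k)"
  unfolding eventually_at
proof (intro exI[of _ d] conjI ballI impI)
  fix q :: "real \<times> real" assume q: "q \<in> {q. fst q < snd q}" "q \<noteq> (k, k) \<and> dist q (k, k) < d"
  have "dist (fst q) k \<le> dist q (k, k)" "dist (snd q) k \<le> dist q (k, k)"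
    using dist_fst_le[of q "(k, k)"] dist_snd_le[of q "(k, k)"] by auto
  then show "P q" using assms(2)[of "fst q" "snd q"] q by (auto simp: dist_real_def)
qed (rule assms(1))

text \<open>The Lipschitz constant below \<open>1\<close> makes \<open>k \<mapsto> k + \<epsilon>(k) cos(2\<pi>x)\<close> increasing, so that distinct
  leaves are disjoint.\<close>

locale slow_lipschitz =
  fixes \<epsilon> :: "real \<Rightarrow> real"
  assumes slow: "(1 / (4 * pi))-lipschitz_on UNIV \<epsilon>"
begin

lemma slow_half: "\<bar>\<epsilon> k2 - \<epsilon> k1\<bar> \<le> \<bar>k2 - k1\<bar> / 2"
proof -
  have "\<bar>\<epsilon> k2 - \<epsilon> k1\<bar> \<le> 1 / (4 * pi) * \<bar>k2 - k1\<bar>"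
    using lipschitz_onD[OF slow, of k2 k1] by (simp add: dist_real_def)
  also have "\<dots> \<le> 1 / 2 * \<bar>k2 - k1\<bar>"
    using pi_ge_two by (intro mult_right_mono) (auto simp: field_simps)
  finally show ?thesis by simp
qed

lemma continuous_eps: "continuous_on A \<epsilon>"
  using lipschitz_on_continuous_on[OF slow] continuous_on_subset by blast

lemma height_increasing:
  assumes "k1 < k2" and "\<bar>w\<bar> \<le> 1"
  shows "k1 + \<epsilon> k1 * w < k2 + \<epsilon> k2 * w"
proof -
  have "\<bar>(\<epsilon> k2 - \<epsilon> k1) * w\<bar> \<le> (k2 - k1) / 2"
    using mult_mono[OF slow_half[of k2 k1] assms(2)] assms(1) by (simp add: abs_mult)
  then have "\<epsilon> k1 * w - \<epsilon> k2 * w \<le> (k2 - k1) / 2" unfolding left_diff_distrib by linarith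
  also have "\<dots> < k2 - k1" using assms(1) by simp
  finally show ?thesis by simp
qed

lemma height_eq_iff: "\<bar>w\<bar> \<le> 1 \<Longrightarrow> k1 + \<epsilon> k1 * w = k2 + \<epsilon> k2 * w \<longleftrightarrow> k1 = k2"
  using height_increasing[of k1 k2 w] height_increasing[of k2 k1 w] by (cases k1 k2 rule: linorder_cases) auto

lemma inj_leaf_chart: "inj (leaf_chart \<epsilon>)"
  by (rule injI) (auto simp: leaf_chart_def height_eq_iff prod_eq_iff)

lemma continuous_leaf_chart: "continuous_on A (leaf_chart \<epsilon>)"
  unfolding leaf_chart_def
  by (intro continuous_intros continuous_on_compose2[OF continuous_eps[of UNIV]]) auto

lemma leaf_chart_rectangle:
  assumes "k1 \<le> k2"
  shows "leaf_chart \<epsilon> ` ({a..b} \<times> {k1..k2}) = {(x, y). a \<le> x \<and> x \<le> b \<and>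
    k1 + \<epsilon> k1 * cos (2 * pi * x) \<le> y \<and> y \<le> k2 + \<epsilon> k2 * cos (2 * pi * x)}" (is "?L = ?R")
proof (intro set_eqI iffI)
  fix z assume "z \<in> ?L"
  then obtain x k where xk: "x \<in> {a..b}" "k1 \<le> k" "k \<le> k2" "z = (x, k + \<epsilon> k * cos (2 * pi * x))"
    by (auto simp: leaf_chart_def)
  then show "z \<in> ?R"
    using height_increasing[of k1 k "cos (2 * pi * x)"] height_increasing[of k k2 "cos (2 * pi * x)"]
    by (cases "k1 = k"; cases "k = k2") auto
next
  fix z assume "z \<in> ?R"
  then obtain x y where z: "z = (x, y)" "a \<le> x" "x \<le> b"
    "k1 + \<epsilon> k1 * cos (2 * pi * x) \<le> y" "y \<le> k2 + \<epsilon> k2 * cos (2 * pi * x)" by auto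
  have "\<exists>k\<ge>k1. k \<le> k2 \<and> k + \<epsilon> k * cos (2 * pi * x) = y"
    by (rule IVT') (use z assms in \<open>auto intro!: continuous_intros continuous_eps\<close>)
  then obtain k where "k \<in> {k1..k2}" "k + \<epsilon> k * cos (2 * pi * x) = y" by auto
  then show "z \<in> ?L" using z by (intro image_eqI[of _ _ "(x, k)"]) (auto simp: leaf_chart_def)
qed

text \<open>The area between the leaves \<open>k1\<close> and \<open>k2\<close> above \<open>[a, b]\<close>.\<close>

definition strip_area :: "real \<Rightarrow> real \<Rightarrow> real \<Rightarrow> real \<Rightarrow> real" where
  "strip_area a b k1 k2 = (b - a) * (k2 - k1) + (\<epsilon> k2 - \<epsilon> k1) * (sin (2 * pi * b) - sin (2 * pi * a)) / (2 * pi)"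

lemma
  assumes "a \<le> b" "k1 \<le> k2"
  defines "R \<equiv> leaf_chart \<epsilon> ` ({a..b} \<times> {k1..k2})"
  shows emeasure_strip: "emeasure lborel R = ennreal (strip_area a b k1 k2)"
    and emeasure_strip_interior: "ennreal (strip_area a b k1 k2) \<le> emeasure lborel (interior R)"
proof -
  define f where "f x = (k2 - k1) + (\<epsilon> k2 - \<epsilon> k1) * cos (2 * pi * x)" for x
  define F where "F x = (k2 - k1) * x + (\<epsilon> k2 - \<epsilon> k1) * sin (2 * pi * x) / (2 * pi)" for x
  have F: "(F has_real_derivative f x) (at x)" for x
    unfolding F_def f_def by (auto intro!: derivative_eq_intros)
  have f0: "f x \<ge> 0" for x
  proof -
    have "f x = (k2 + \<epsilon> k2 * cos (2 * pi * x)) - (k1 + \<epsilon> k1 * cos (2 * pi * x))"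
      by (simp add: f_def algebra_simps)
    then show ?thesis
      using height_increasing[of k1 k2 "cos (2 * pi * x)"] assms(2) by (cases "k1 = k2") auto
  qed
  have meas: "f \<in> borel_measurable borel" unfolding f_def by measurable
  have area: "F b - F a = strip_area a b k1 k2"
    by (simp add: F_def strip_area_def field_simps)
  have width: "emeasure lborel {k1 + \<epsilon> k1 * cos (2 * pi * x)..k2 + \<epsilon> k2 * cos (2 * pi * x)} = ennreal (f x)"
     "emeasure lborel {k1 + \<epsilon> k1 * cos (2 * pi * x)<..<k2 + \<epsilon> k2 * cos (2 * pi * x)} = ennreal (f x)" for x
    using f0[of x] by (auto simp: f_def algebra_simps)
  have "compact R" unfolding R_def
    by (intro compact_continuous_image continuous_leaf_chart compact_Times compact_Icc)
  then have "emeasure lborel R = ennreal (F b - F a)"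
  proof (intro emeasure_eq_by_vertical_slices[where f=f and F=F])
    fix x
    have "{y. (x, y) \<in> R} = (if x \<in> {a..b} then {k1 + \<epsilon> k1 * cos (2 * pi * x)..k2 + \<epsilon> k2 * cos (2 * pi * x)} else {})"
      unfolding R_def leaf_chart_rectangle[OF assms(2)] by auto
    then show "emeasure lborel {y. (x, y) \<in> R} = ennreal (f x) * indicator {a..b} x"
      by (simp add: width)
  qed (use assms F f0 meas in \<open>auto simp: borel_compact\<close>)
  then show "emeasure lborel R = ennreal (strip_area a b k1 k2)" by (simp add: area)
  \<comment> \<open>The open strip has the same area and lies in the interior of the closed one.\<close>
  define R' where "R' = {z. a < fst z \<and> fst z < b \<and>
    k1 + \<epsilon> k1 * cos (2 * pi * fst z) < snd z \<and> snd z < k2 + \<epsilon> k2 * cos (2 * pi * fst z)}"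
  have op: "open R'" unfolding R'_def
    by (intro open_Collect_conj open_Collect_less continuous_intros)
  then have "emeasure lborel R' = ennreal (F b - F a)"
  proof (intro emeasure_eq_by_vertical_slices[where f=f and F=F])
    fix x assume "x \<noteq> a" "x \<noteq> b"
    then have "{y. (x, y) \<in> R'} = (if x \<in> {a..b} then {k1 + \<epsilon> k1 * cos (2 * pi * x)<..<k2 + \<epsilon> k2 * cos (2 * pi * x)} else {})"
      unfolding R'_def by auto
    then show "emeasure lborel {y. (x, y) \<in> R'} = ennreal (f x) * indicator {a..b} x"
      by (simp add: width)
  qed (use assms F f0 meas in auto)
  moreover have "R' \<subseteq> interior R"
    by (rule interior_maximal[OF _ op]) (auto simp: R'_def R_def leaf_chart_rectangle[OF assms(2)])
  ultimately show "ennreal (strip_area a b k1 k2) \<le> emeasure lborel (interior R)"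
    by (metis area emeasure_mono borel_open open_interior sets_lborel)
qed

text \<open>The sine increment is at most \<open>2\<pi>(b - a)\<close>, so the second summand of \<open>strip_area\<close> is at most half of
  the first.\<close>

lemma strip_area_pos:
  assumes "a < b" "k1 < k2"
  shows "strip_area a b k1 k2 > 0"
proof -
  have "\<bar>sin (2 * pi * b) - sin (2 * pi * a)\<bar> \<le> 2 * pi * (b - a)"
  proof -
    have "\<exists>z>2*pi*a. z < 2*pi*b \<and> sin (2*pi*b) - sin (2*pi*a) = (2*pi*b - 2*pi*a) * cos z"
      by (rule MVT2) (use assms in \<open>auto intro!: derivative_eq_intros\<close>)
    then obtain z where z: "sin (2*pi*b) - sin (2*pi*a) = (2*pi*(b - a)) * cos z"
      by (auto simp: algebra_simps)
    have "\<bar>(2*pi*(b - a)) * cos z\<bar> = (2*pi*(b - a)) * \<bar>cos z\<bar>"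
      using assms by (simp add: abs_mult)
    also have "\<dots> \<le> (2*pi*(b - a)) * 1" using assms by (intro mult_left_mono) auto
    finally show ?thesis by (simp add: z)
  qed
  then have "\<bar>(\<epsilon> k2 - \<epsilon> k1)\<bar> * \<bar>sin (2 * pi * b) - sin (2 * pi * a)\<bar> \<le> (k2 - k1) / 2 * (2 * pi * (b - a))"
    using slow_half[of k2 k1] assms by (intro mult_mono) auto
  then have "\<bar>(\<epsilon> k2 - \<epsilon> k1) * (sin (2 * pi * b) - sin (2 * pi * a)) / (2 * pi)\<bar> \<le> (k2 - k1) * (b - a) / 2"
    by (simp only: abs_mult abs_divide) (simp add: field_simps)
  moreover have "(b - a) * (k2 - k1) > 0" using assms by simp
  ultimately show ?thesis unfolding strip_area_def mult.commute[of "k2 - k1"] abs_le_iff by linarith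
qed

lemma pair_quotient_bounded: "\<bar>pair_quotient \<epsilon> q\<bar> \<le> 1"
proof (cases "fst q = snd q")
  case False
  have "\<bar>\<epsilon> (snd q) - \<epsilon> (fst q)\<bar> \<le> \<bar>snd q - fst q\<bar>"
    by (rule order_trans[OF slow_half]) simp
  then show ?thesis using False by (simp add: abs_divide divide_simps)
qed simp

text \<open>Here \<open>F\<close> is a lift of the straightening.  Pulling the leaf coordinates back by \<open>F\<close> gives
  \<open>(x, k) \<mapsto> (A x k, C k)\<close>, the height being independent of \<open>x\<close> because an arc of a leaf comes from a
  single horizontal line.  Conversely horizontal neighbours land on a common leaf, so different leaves
  have different heights and \<open>C\<close> is injective.\<close>

lemma plane_straightening_coordinates:
  fixes F :: "real \<times> real \<Rightarrow> real \<times> real"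
  assumes W: "open W" and F: "continuous_on W F" "inj_on F W"
    and to_leaf: "\<And>z z'. z \<in> W \<Longrightarrow> z' \<in> W \<Longrightarrow> snd z = snd z' \<Longrightarrow>
      \<exists>k x x'. F z = leaf_chart \<epsilon> (x, k) \<and> F z' = leaf_chart \<epsilon> (x', k)"
    and to_line: "\<And>z z' k x x'. z \<in> W \<Longrightarrow> z' \<in> W \<Longrightarrow> F z = leaf_chart \<epsilon> (x, k) \<Longrightarrow> F z' = leaf_chart \<epsilon> (x', k) \<Longrightarrow>
      leaf_chart \<epsilon> ` (closed_segment x x' \<times> {k}) \<subseteq> F ` W \<Longrightarrow> snd z = snd z'"
    and P: "leaf_chart \<epsilon> (x0, c0) \<in> F ` W"
  obtains d A C where "d > 0"
    "\<And>x k. x \<in> {x0-d..x0+d} \<Longrightarrow> k \<in> {c0-d..c0+d} \<Longrightarrow> (A x k, C k) \<in> W \<and> F (A x k, C k) = leaf_chart \<epsilon> (x, k)"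
    "continuous_on ({x0-d..x0+d} \<times> {c0-d..c0+d}) (\<lambda>(x, k). A x k)"
    "continuous_on {c0-d..c0+d} C" "inj_on C {c0-d..c0+d}"
    "\<And>k. k \<in> {c0-d..c0+d} \<Longrightarrow> inj_on (\<lambda>x. A x k) {x0-d..x0+d}"
proof -
  have FW: "open (F ` W)" using invariance_of_domain[OF F(1) W F(2)] .
  have "open (leaf_chart \<epsilon> -` (F ` W))"
    using FW continuous_leaf_chart continuous_on_open_vimage[of UNIV] by auto
  then obtain r where r: "r > 0" "ball (x0, c0) r \<subseteq> leaf_chart \<epsilon> -` (F ` W)"
    using P by (meson openE vimageI)
  define d where "d = r / 3"
  have d: "d > 0" using r by (simp add: d_def)
  let ?X = "{x0-d..x0+d}" and ?K = "{c0-d..c0+d}"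
  have box: "?X \<times> ?K \<subseteq> leaf_chart \<epsilon> -` (F ` W)"
  proof
    fix q assume "q \<in> ?X \<times> ?K"
    then have "dist (fst q) x0 \<le> d" "dist (snd q) c0 \<le> d" by (auto simp: dist_real_def)
    then have "dist q (x0, c0) \<le> 2 * d"
      using norm_Pair_le[of "fst q - x0" "snd q - c0"] by (auto simp: dist_norm minus_prod_def)
    then show "q \<in> leaf_chart \<epsilon> -` (F ` W)"
      using r by (intro subsetD[OF r(2)]) (auto simp: dist_commute d_def)
  qed
  define h where "h q = inv_into W F (leaf_chart \<epsilon> q)" for q
  have h: "h q \<in> W" "F (h q) = leaf_chart \<epsilon> q" if "q \<in> ?X \<times> ?K" for q
  proof -
    have "leaf_chart \<epsilon> q \<in> F ` W" using box that by blast
    then show "h q \<in> W" "F (h q) = leaf_chart \<epsilon> q"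
      unfolding h_def by (auto simp: inv_into_into f_inv_into_f)
  qed
  have conth: "continuous_on (?X \<times> ?K) h"
    unfolding h_def
    by (rule continuous_on_compose2[OF continuous_on_inverse_open[OF W F(1) _ inv_into_f_f[OF F(2)]] continuous_leaf_chart])
       (use box in auto)
  define A where "A x k = fst (h (x, k))" for x k
  define C where "C k = snd (h (x0, k))" for k
  have x0: "x0 \<in> ?X" using d by auto
  have hAC: "h (x, k) = (A x k, C k)" if "x \<in> ?X" "k \<in> ?K" for x k
  proof -
    have "snd (h (x, k)) = snd (h (x0, k))"
    proof (rule to_line[where k=k and x=x and x'=x0])
      show "leaf_chart \<epsilon> ` (closed_segment x x0 \<times> {k}) \<subseteq> F ` W"
      proof -
        have "closed_segment x x0 \<subseteq> ?X" using that x0 by (intro closed_segment_subset) auto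
        then show ?thesis using box that by blast
      qed
    qed (use h that x0 in auto)
    then show ?thesis by (simp add: A_def C_def prod_eq_iff)
  qed
  show thesis
  proof (rule that[OF d])
    show "(A x k, C k) \<in> W \<and> F (A x k, C k) = leaf_chart \<epsilon> (x, k)" if "x \<in> ?X" "k \<in> ?K" for x k
      using h[of "(x, k)"] hAC that by auto
    show "continuous_on (?X \<times> ?K) (\<lambda>(x, k). A x k)"
      using continuous_on_fst[OF conth] by (simp add: A_def case_prod_beta)
    show "continuous_on ?K C" unfolding C_def
      by (intro continuous_on_snd continuous_on_compose2[OF conth]) (use x0 in \<open>auto intro!: continuous_intros\<close>)
    show "inj_on C ?K"
    proof (rule inj_onI)
      fix k k' assume k: "k \<in> ?K" "k' \<in> ?K" "C k = C k'"
      have "\<exists>l x x'. F (h (x0, k)) = leaf_chart \<epsilon> (x, l) \<and> F (h (x0, k')) = leaf_chart \<epsilon> (x', l)"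
        by (rule to_leaf) (use h(1)[of "(x0, k)"] h(1)[of "(x0, k')"] k[unfolded C_def] x0 in simp_all)
      then obtain l x x' where "leaf_chart \<epsilon> (x0, k) = leaf_chart \<epsilon> (x, l)" "leaf_chart \<epsilon> (x0, k') = leaf_chart \<epsilon> (x', l)"
        using h k x0 by (metis mem_Sigma_iff)
      then show "k = k'" using inj_leaf_chart by (auto dest: injD)
    qed
    show "inj_on (\<lambda>x. A x k) ?X" if k: "k \<in> ?K" for k
    proof (rule inj_onI)
      fix x x' assume "x \<in> ?X" "x' \<in> ?X" "A x k = A x' k"
      then have "leaf_chart \<epsilon> (x, k) = leaf_chart \<epsilon> (x', k)"
        using h[of "(x, k)"] h[of "(x', k)"] hAC k by (metis mem_Sigma_iff)
      then show "x = x'" using inj_leaf_chart by (auto dest: injD)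
    qed
  qed
qed

text \<open>The preimage of the strip under \<open>F\<close> has as horizontal slices the segments from \<open>A a k\<close> to
  \<open>A b k\<close> at the heights \<open>C k\<close>, which fill an interval of length \<open>\<bar>C k2 - C k1\<bar>\<close>; and it has the
  same area as the strip.\<close>

lemma strip_area_between:
  fixes F :: "real \<times> real \<Rightarrow> real \<times> real" and A :: "real \<Rightarrow> real \<Rightarrow> real" and C :: "real \<Rightarrow> real"
  assumes ab: "a < b" and k: "k1 < k2"
    and AC: "\<And>x k. x \<in> {a..b} \<Longrightarrow> k \<in> {k1..k2} \<Longrightarrow> (A x k, C k) \<in> W \<and> F (A x k, C k) = leaf_chart \<epsilon> (x, k)"
    and A: "continuous_on ({a..b} \<times> {k1..k2}) (\<lambda>(x, k). A x k)" "\<And>k. k \<in> {k1..k2} \<Longrightarrow> inj_on (\<lambda>x. A x k) {a..b}"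
    and C: "continuous_on {k1..k2} C" "inj_on C {k1..k2}"
    and area: "\<And>K. compact K \<Longrightarrow> K \<subseteq> W \<Longrightarrow> emeasure lborel K \<le> emeasure lborel (F ` K) \<and>
       emeasure lborel (interior (F ` K)) \<le> emeasure lborel K"
    and m: "0 \<le> m" "0 \<le> M" "\<And>k. k \<in> {k1..k2} \<Longrightarrow> m \<le> \<bar>A b k - A a k\<bar> \<and> \<bar>A b k - A a k\<bar> \<le> M"
  shows "m * \<bar>C k2 - C k1\<bar> \<le> strip_area a b k1 k2 \<and> strip_area a b k1 k2 \<le> M * \<bar>C k2 - C k1\<bar>"
proof -
  define h where "h q = (A (fst q) (snd q), C (snd q))" for q
  define Q where "Q = {a..b} \<times> {k1..k2}"
  have "continuous_on Q h" unfolding h_def Q_def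
    by (intro continuous_on_Pair continuous_on_compose2[OF C(1)] continuous_intros)
       (use A(1) in \<open>auto simp: case_prod_beta\<close>)
  then have K: "compact (h ` Q)" unfolding Q_def
    by (intro compact_continuous_image compact_Times compact_Icc)
  have KW: "h ` Q \<subseteq> W" using AC by (auto simp: Q_def h_def)
  have FK: "F ` h ` Q = leaf_chart \<epsilon> ` Q"
    unfolding image_image by (intro image_cong) (use AC in \<open>auto simp: Q_def h_def\<close>)
  have "emeasure lborel (h ` Q) = ennreal (strip_area a b k1 k2)"
    using area[OF K KW, unfolded FK] emeasure_strip[of a b k1 k2] emeasure_strip_interior[of a b k1 k2] ab k
    unfolding Q_def[symmetric] by (intro antisym) auto
  moreover
  define u v where "u = min (C k1) (C k2)" and "v = max (C k1) (C k2)"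
  have Cim: "C ` {k1..k2} = {u..v}"
    using continuous_injective_image_segment_1[of k1 k2 C] C k
    by (auto simp: closed_segment_eq_real_ivl u_def v_def min_def max_def)
  have uv: "v - u = \<bar>C k2 - C k1\<bar>" "u \<le> v" by (auto simp: u_def v_def)
  have slice: "{x. (x, C l) \<in> h ` Q} = closed_segment (A a l) (A b l)" if l: "l \<in> {k1..k2}" for l
  proof -
    have "{x. (x, C l) \<in> h ` Q} = (\<lambda>x. A x l) ` {a..b}"
      using C(2) l by (force simp: h_def Q_def dest: inj_onD)
    moreover have "continuous_on {a..b} (\<lambda>x. A x l)"
    proof -
      have "continuous_on {a..b} (\<lambda>x. (x, l))" by (rule continuous_on_Pair) simp_all
      then show ?thesis using continuous_on_compose2[OF A(1), of "{a..b}" "\<lambda>x. (x, l)"] l by (simp add: image_subset_iff)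
    qed
    ultimately show ?thesis
      using continuous_injective_image_segment_1[of a b "\<lambda>x. A x l"] A(2)[OF l] ab
      by (simp add: closed_segment_eq_real_ivl)
  qed
  have meas_slice: "emeasure lborel (closed_segment p q) = ennreal \<bar>q - p\<bar>" for p q :: real
    by (auto simp: closed_segment_eq_real_ivl)
  have "ennreal (m * (v - u)) \<le> emeasure lborel (h ` Q)" "emeasure lborel (h ` Q) \<le> ennreal (M * (v - u))"
  proof (rule_tac [!] emeasure_between_by_horizontal_slices)
    show "h ` Q \<in> sets borel" using K borel_compact by blast
    then show "h ` Q \<in> sets borel" .
    { fix y assume "y \<in> {u..v}"
      then obtain l where l: "l \<in> {k1..k2}" "y = C l" using Cim by blast
      then show "ennreal m \<le> emeasure lborel {x. (x, y) \<in> h ` Q} \<and> emeasure lborel {x. (x, y) \<in> h ` Q} \<le> ennreal M"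
        using m(3)[OF l(1)] by (simp add: slice meas_slice ennreal_leI)
      then show "ennreal m \<le> emeasure lborel {x. (x, y) \<in> h ` Q} \<and> emeasure lborel {x. (x, y) \<in> h ` Q} \<le> ennreal M" . }
    { fix y assume "y \<notin> {u..v}"
      then show "{x. (x, y) \<in> h ` Q} = {}" using Cim by (auto simp: h_def Q_def)
      then show "{x. (x, y) \<in> h ` Q} = {}" . }
  qed (use m uv in auto)
  ultimately show ?thesis
    using m(1) strip_area_pos[OF ab k] uv by (simp add: ennreal_le_iff ennreal_le_iff2)
qed

lemma strip_area_quotient_tendsto:
  fixes F :: "real \<times> real \<Rightarrow> real \<times> real" and A :: "real \<Rightarrow> real \<Rightarrow> real" and C :: "real \<Rightarrow> real"
  assumes ab: "a < b" and l: "l \<in> {u<..<v}"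
    and AC: "\<And>x k. x \<in> {a..b} \<Longrightarrow> k \<in> {u..v} \<Longrightarrow> (A x k, C k) \<in> W \<and> F (A x k, C k) = leaf_chart \<epsilon> (x, k)"
    and A: "continuous_on ({a..b} \<times> {u..v}) (\<lambda>(x, k). A x k)" "\<And>k. k \<in> {u..v} \<Longrightarrow> inj_on (\<lambda>x. A x k) {a..b}"
    and C: "continuous_on {u..v} C" "inj_on C {u..v}"
    and area: "\<And>K. compact K \<Longrightarrow> K \<subseteq> W \<Longrightarrow> emeasure lborel K \<le> emeasure lborel (F ` K) \<and>
       emeasure lborel (interior (F ` K)) \<le> emeasure lborel K"
  shows "((\<lambda>q. strip_area a b (fst q) (snd q) / \<bar>C (snd q) - C (fst q)\<bar>) \<longlongrightarrow> \<bar>A b l - A a l\<bar>) (at_diagonal l)"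
proof (rule tendstoI)
  fix e :: real assume e: "e > 0"
  define w where "w k = \<bar>A b k - A a k\<bar>" for k
  have wl: "w l > 0" using A(2)[of l] l ab by (auto simp: w_def dest: inj_onD)
  define e' where "e' = min (e / 2) (w l / 2)"
  have e': "e' > 0" "e' < e" "e' \<le> w l" using e wl by (auto simp: e'_def)
  have "continuous_on {u..v} w"
  proof -
    have "continuous_on {u..v} (\<lambda>k. A x k)" if "x \<in> {a..b}" for x
    proof -
      have "continuous_on {u..v} (\<lambda>k. (x, k))" by (rule continuous_on_Pair) simp_all
      then show ?thesis using continuous_on_compose2[OF A(1), of "{u..v}" "\<lambda>k. (x, k)"] that by (simp add: image_subset_iff)
    qed
    then show ?thesis unfolding w_def using ab by (intro continuous_intros) auto
  qed
  then obtain d0 where d0: "d0 > 0" "\<And>k. k \<in> {u..v} \<Longrightarrow> dist k l < d0 \<Longrightarrow> dist (w k) (w l) < e'"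
    using l e'(1) unfolding continuous_on_iff by (metis greaterThanLessThan_subseteq_atLeastAtMost_iff order_refl subsetD)
  define d where "d = Min {d0, l - u, v - l}"
  have d: "d > 0" "d \<le> d0" "d \<le> l - u" "d \<le> v - l" using d0(1) l by (auto simp: d_def)
  show "\<forall>\<^sub>F q in at_diagonal l. dist (strip_area a b (fst q) (snd q) / \<bar>C (snd q) - C (fst q)\<bar>) \<bar>A b l - A a l\<bar> < e"
  proof (rule eventually_at_diagonal[OF d(1)])
    fix k1 k2 assume k: "k1 < k2" "\<bar>k1 - l\<bar> < d" "\<bar>k2 - l\<bar> < d"
    then have sub: "{k1..k2} \<subseteq> {u..v}" using d by auto
    have near: "w l - e' \<le> w k \<and> w k \<le> w l + e'" if "k \<in> {k1..k2}" for k
      using d0(2)[of k] that k d sub by (fastforce simp: dist_real_def)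
    have "(w l - e') * \<bar>C k2 - C k1\<bar> \<le> strip_area a b k1 k2 \<and> strip_area a b k1 k2 \<le> (w l + e') * \<bar>C k2 - C k1\<bar>"
    proof (rule strip_area_between[OF ab k(1), where A=A and W=W and F=F])
      show "continuous_on ({a..b} \<times> {k1..k2}) (\<lambda>(x, k). A x k)"
        by (rule continuous_on_subset[OF A(1)]) (use sub in auto)
      show "continuous_on {k1..k2} C" "inj_on C {k1..k2}"
        by (rule continuous_on_subset[OF C(1) sub], rule inj_on_subset[OF C(2) sub])
    qed (use sub AC A(2) area near e' wl in \<open>auto simp: w_def\<close>)
    moreover have "\<bar>C k2 - C k1\<bar> > 0"
      using inj_onD[OF C(2), of k1 k2] sub k by auto
    ultimately have "\<bar>strip_area a b k1 k2 / \<bar>C k2 - C k1\<bar> - w l\<bar> \<le> e'"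
      by (simp add: abs_le_iff divide_simps algebra_simps)
    then show "dist (strip_area a b (fst (k1, k2)) (snd (k1, k2)) / \<bar>C (snd (k1, k2)) - C (fst (k1, k2))\<bar>) \<bar>A b l - A a l\<bar> < e"
      using e' by (simp add: dist_real_def w_def)
  qed
qed

text \<open>The limits of \<open>strip_area_quotient_tendsto\<close> for \<open>[a, b]\<close> and \<open>[a, b']\<close> have a quotient from which
  the unknown increments of \<open>C\<close> cancel.\<close>

theorem strict_derivative_of_plane_straightening:
  fixes F :: "real \<times> real \<Rightarrow> real \<times> real"
  assumes W: "open W" and F: "continuous_on W F" "inj_on F W"
    and area: "\<And>K. compact K \<Longrightarrow> K \<subseteq> W \<Longrightarrow> emeasure lborel K \<le> emeasure lborel (F ` K) \<and>
       emeasure lborel (interior (F ` K)) \<le> emeasure lborel K"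
    and to_leaf: "\<And>z z'. z \<in> W \<Longrightarrow> z' \<in> W \<Longrightarrow> snd z = snd z' \<Longrightarrow>
      \<exists>k x x'. F z = leaf_chart \<epsilon> (x, k) \<and> F z' = leaf_chart \<epsilon> (x', k)"
    and to_line: "\<And>z z' k x x'. z \<in> W \<Longrightarrow> z' \<in> W \<Longrightarrow> F z = leaf_chart \<epsilon> (x, k) \<Longrightarrow> F z' = leaf_chart \<epsilon> (x', k) \<Longrightarrow>
      leaf_chart \<epsilon> ` (closed_segment x x' \<times> {k}) \<subseteq> F ` W \<Longrightarrow> snd z = snd z'"
    and P: "leaf_chart \<epsilon> (x0, c0) \<in> F ` W"
  shows "\<exists>d>0. \<forall>l\<in>{c0-d<..<c0+d}. \<exists>D. (pair_quotient \<epsilon> \<longlongrightarrow> D) (at_diagonal l)"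
proof -
  obtain d A C where d: "d > 0"
    and AC: "\<And>x k. x \<in> {x0-d..x0+d} \<Longrightarrow> k \<in> {c0-d..c0+d} \<Longrightarrow> (A x k, C k) \<in> W \<and> F (A x k, C k) = leaf_chart \<epsilon> (x, k)"
    and A: "continuous_on ({x0-d..x0+d} \<times> {c0-d..c0+d}) (\<lambda>(x, k). A x k)"
    and C: "continuous_on {c0-d..c0+d} C" "inj_on C {c0-d..c0+d}"
    and A_inj: "\<And>k. k \<in> {c0-d..c0+d} \<Longrightarrow> inj_on (\<lambda>x. A x k) {x0-d..x0+d}"
    by (rule plane_straightening_coordinates[OF W F to_leaf to_line P]) blast+
  obtain a b b' where a: "x0 - d \<le> a" and b: "a < b" "b \<le> x0 + d" and b': "a < b'" "b' \<le> x0 + d"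
    and nc: "(b - a) * (sin (2 * pi * b') - sin (2 * pi * a)) \<noteq> (b' - a) * (sin (2 * pi * b) - sin (2 * pi * a))"
    using exists_noncollinear_sine_points[OF d, of x0] by metis
  define s where "s y = (sin (2 * pi * y) - sin (2 * pi * a)) / (2 * pi)" for y
  have strip: "strip_area a y k1 k2 = (k2 - k1) * ((y - a) + pair_quotient \<epsilon> (k1, k2) * s y)" if "k1 < k2" for y k1 k2
    using that by (simp add: strip_area_def s_def field_simps)
  have "\<exists>D. (pair_quotient \<epsilon> \<longlongrightarrow> D) (at_diagonal l)" if l: "l \<in> {c0-d<..<c0+d}" for l
  proof -
    have lim: "((\<lambda>q. strip_area a y (fst q) (snd q) / \<bar>C (snd q) - C (fst q)\<bar>) \<longlongrightarrow> \<bar>A y l - A a l\<bar>) (at_diagonal l)"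
      if y: "a < y" "y \<le> x0 + d" for y
    proof (rule strip_area_quotient_tendsto[OF y(1) l, where W=W and F=F])
      show "continuous_on ({a..y} \<times> {c0-d..c0+d}) (\<lambda>(x, k). A x k)"
        by (rule continuous_on_subset[OF A]) (use a y in auto)
      show "inj_on (\<lambda>x. A x k) {a..y}" if "k \<in> {c0-d..c0+d}" for k
        by (rule inj_on_subset[OF A_inj[OF that]]) (use a y in auto)
    qed (use a y AC C area in auto)
    have wb: "\<bar>A b l - A a l\<bar> \<noteq> 0" using inj_onD[OF A_inj, of l b a] l a b by auto
    have lim2: "((\<lambda>q. (strip_area a b' (fst q) (snd q) / \<bar>C (snd q) - C (fst q)\<bar>)
        / (strip_area a b (fst q) (snd q) / \<bar>C (snd q) - C (fst q)\<bar>)) \<longlongrightarrow> \<bar>A b' l - A a l\<bar> / \<bar>A b l - A a l\<bar>) (at_diagonal l)"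
      by (intro tendsto_divide lim b b' wb)
    define r where "r = min (l - (c0 - d)) (c0 + d - l)"
    have r: "r > 0" using l by (auto simp: r_def)
    have "\<forall>\<^sub>F q in at_diagonal l. (strip_area a b' (fst q) (snd q) / \<bar>C (snd q) - C (fst q)\<bar>)
        / (strip_area a b (fst q) (snd q) / \<bar>C (snd q) - C (fst q)\<bar>) =
        ((b' - a) + pair_quotient \<epsilon> q * s b') / ((b - a) + pair_quotient \<epsilon> q * s b)"
    proof (rule eventually_at_diagonal[OF r])
      fix k1 k2 assume k: "k1 < k2" "\<bar>k1 - l\<bar> < r" "\<bar>k2 - l\<bar> < r"
      then have "k1 \<in> {c0-d..c0+d}" "k2 \<in> {c0-d..c0+d}" by (auto simp: r_def)
      then have "\<bar>C k2 - C k1\<bar> \<noteq> 0" using inj_onD[OF C(2), of k1 k2] k by auto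
      then show "(strip_area a b' (fst (k1, k2)) (snd (k1, k2)) / \<bar>C (snd (k1, k2)) - C (fst (k1, k2))\<bar>)
        / (strip_area a b (fst (k1, k2)) (snd (k1, k2)) / \<bar>C (snd (k1, k2)) - C (fst (k1, k2))\<bar>) =
        ((b' - a) + pair_quotient \<epsilon> (k1, k2) * s b') / ((b - a) + pair_quotient \<epsilon> (k1, k2) * s b)"
        using k(1) by (simp add: strip[OF k(1)])
    qed
    then have lim3: "((\<lambda>q. ((b' - a) + pair_quotient \<epsilon> q * s b') / ((b - a) + pair_quotient \<epsilon> q * s b))
        \<longlongrightarrow> \<bar>A b' l - A a l\<bar> / \<bar>A b l - A a l\<bar>) (at_diagonal l)"
      using lim2 tendsto_cong by fast
    show ?thesis
    proof (rule convergent_of_moebius_convergent[OF at_diagonal_neq_bot _ _ lim3])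
      show "\<forall>\<^sub>F q in at_diagonal l. \<bar>pair_quotient \<epsilon> q\<bar> \<le> 1"
        using pair_quotient_bounded by (simp add: always_eventually)
      show "\<forall>\<^sub>F q in at_diagonal l. (b - a) + pair_quotient \<epsilon> q * s b \<noteq> 0"
      proof (rule eventually_at_diagonal[OF r])
        fix k1 k2 :: real assume k: "k1 < k2"
        show "(b - a) + pair_quotient \<epsilon> (k1, k2) * s b \<noteq> 0"
          using strip_area_pos[OF b(1) k] strip[OF k, of b] by auto
      qed
      show "(b - a) * s b' \<noteq> (b' - a) * s b" using nc by (simp add: s_def field_simps)
    qed
  qed
  then show ?thesis using d by blast
qed

end

text \<open>Letting one argument of the difference quotient converge first gives the derivative at nearby
  points, with the same error bound; this is continuity of the derivative.\<close>

lemma C1_of_strict_derivative: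
  fixes f :: "real \<Rightarrow> real"
  assumes "\<And>l. l \<in> {u<..<v} \<Longrightarrow> \<exists>D. (pair_quotient f \<longlongrightarrow> D) (at_diagonal l)"
  obtains D where "\<And>l. l \<in> {u<..<v} \<Longrightarrow> (f has_real_derivative D l) (at l)" "continuous_on {u<..<v} D"
proof -
  have "\<forall>l\<in>{u<..<v}. \<exists>D. (pair_quotient f \<longlongrightarrow> D) (at_diagonal l)" using assms by blast
  then obtain D where D: "\<And>l. l \<in> {u<..<v} \<Longrightarrow> (pair_quotient f \<longlongrightarrow> D l) (at_diagonal l)"
    by (rule bchoice[THEN exE]) blast
  have near: "\<exists>d>0. \<forall>k1 k2. k1 < k2 \<and> \<bar>k1 - l\<bar> < d \<and> \<bar>k2 - l\<bar> < d \<longrightarrow> \<bar>(f k2 - f k1) / (k2 - k1) - D l\<bar> < e"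
    if l: "l \<in> {u<..<v}" and e: "e > 0" for l e
  proof -
    have "\<forall>\<^sub>F q in at_diagonal l. dist (pair_quotient f q) (D l) < e" using tendstoD[OF D[OF l] e] .
    then obtain d where d: "d > 0"
      "\<And>q. q \<in> {q. fst q < snd q} \<Longrightarrow> q \<noteq> (l, l) \<Longrightarrow> dist q (l, l) < d \<Longrightarrow> dist (pair_quotient f q) (D l) < e"
      unfolding eventually_at by auto
    have "\<bar>(f k2 - f k1) / (k2 - k1) - D l\<bar> < e" if k: "k1 < k2" "\<bar>k1 - l\<bar> < d / 2" "\<bar>k2 - l\<bar> < d / 2" for k1 k2
    proof -
      have "dist (k1, k2) (l, l) < d"
        using norm_Pair_le[of "k1 - l" "k2 - l"] k by (simp add: dist_norm)
      then show ?thesis using d(2)[of "(k1, k2)"] k by (auto simp: dist_real_def)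
    qed
    then show ?thesis using d(1) by (intro exI[of _ "d / 2"]) auto
  qed
  have der: "(f has_real_derivative D l) (at l)" if l: "l \<in> {u<..<v}" for l
    unfolding has_field_derivative_iff
  proof (rule LIM_I)
    fix e :: real assume "e > 0"
    from near[OF l this] obtain d where d: "d > 0"
      "\<And>k1 k2. k1 < k2 \<Longrightarrow> \<bar>k1 - l\<bar> < d \<Longrightarrow> \<bar>k2 - l\<bar> < d \<Longrightarrow> \<bar>(f k2 - f k1) / (k2 - k1) - D l\<bar> < e" by metis
    have "norm ((f y - f l) / (y - l) - D l) < e" if "y \<noteq> l" "norm (y - l) < d" for y
    proof (cases "l < y")
      case False
      then have "(f l - f y) / (l - y) = (f y - f l) / (y - l)"
        using that by (simp add: field_simps)
      then show ?thesis using d(2)[of y l] that d(1) False by auto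
    qed (use d(2)[of l y] that d(1) in auto)
    then show "\<exists>s>0. \<forall>y. y \<noteq> l \<and> norm (y - l) < s \<longrightarrow> norm ((f y - f l) / (y - l) - D l) < e"
      using d(1) by blast
  qed
  moreover have "continuous_on {u<..<v} D"
    unfolding continuous_on_iff
  proof (intro ballI allI impI)
    fix l e :: real assume l: "l \<in> {u<..<v}" and e: "e > 0"
    then obtain d where d: "d > 0"
      "\<And>k1 k2. k1 < k2 \<Longrightarrow> \<bar>k1 - l\<bar> < d \<Longrightarrow> \<bar>k2 - l\<bar> < d \<Longrightarrow> \<bar>(f k2 - f k1) / (k2 - k1) - D l\<bar> < e / 2"
      using near[OF l, of "e / 2"] by (metis half_gt_zero)
    have "dist (D k) (D l) < e" if k: "k \<in> {u<..<v}" "dist k l < d" for k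
    proof -
      have "((\<lambda>y. (f y - f k) / (y - k)) \<longlongrightarrow> D k) (at_right k)"
        using der[OF k(1)] unfolding has_field_derivative_iff by (rule filterlim_mono) (auto simp: at_le)
      then have "((\<lambda>y. \<bar>(f y - f k) / (y - k) - D l\<bar>) \<longlongrightarrow> \<bar>D k - D l\<bar>) (at_right k)"
        by (intro tendsto_intros)
      moreover have "\<forall>\<^sub>F y in at_right k. \<bar>(f y - f k) / (y - k) - D l\<bar> \<le> e / 2"
      proof -
        have "\<forall>\<^sub>F y in at_right k. y < l + d \<and> y > k"
          using k(2) by (intro eventually_conj eventually_at_right_less eventually_at_rightI[of k "l + d"]) (auto simp: dist_real_def)
        then show ?thesis
          by eventually_elim (use d(2)[of k] k(2) in \<open>fastforce simp: dist_real_def\<close>)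
      qed
      ultimately have "\<bar>D k - D l\<bar> \<le> e / 2"
        by (intro tendsto_upperbound) auto
      then show ?thesis using e by (simp add: dist_real_def)
    qed
    then show "\<exists>d>0. \<forall>k\<in>{u<..<v}. dist k l < d \<longrightarrow> dist (D k) (D l) < e" using d(1) by blast
  qed
  ultimately show thesis using that by blast
qed

section \<open>Local lifts to the cover\<close>

text \<open>What the real line and the circle share beyond \<open>coordinate_line\<close>: the covering map is open, and
  injective on intervals of length \<open>1\<close>.\<close>

class line_cover = coordinate_line +
  assumes open_cover_image: "open S \<Longrightarrow> open (cover ` S)"
    and cover_locally_injective: "cover s = cover t \<Longrightarrow> \<bar>s - t\<bar> < 1 \<Longrightarrow> s = t"

instance real :: line_cover
  by standard (auto simp: cover_real_def)

lemma cover_circle_eq_iff: "(cover s :: circle) = cover t \<longleftrightarrow> s - t \<in> \<int>"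
  unfolding cover_circle_def by (rule circle.abs_eq_iff)

instance circle :: line_cover
proof
  fix S :: "real set" assume S: "open S"
  have "cover -` (cover ` S :: circle set) = (\<Union>n\<in>\<int>. (\<lambda>x. n + x) ` S)"
  proof (intro set_eqI iffI)
    fix t :: real assume "t \<in> cover -` (cover ` S :: circle set)"
    then obtain s where "s \<in> S" "t - s \<in> \<int>" by (auto simp: cover_circle_eq_iff)
    then show "t \<in> (\<Union>n\<in>\<int>. (\<lambda>x. n + x) ` S)" by (intro UN_I[of "t - s"] image_eqI[of _ _ s]) auto
  next
    fix t :: real assume "t \<in> (\<Union>n\<in>\<int>. (\<lambda>x. n + x) ` S)"
    then obtain n s where "n \<in> \<int>" "s \<in> S" "t = n + s" by auto
    then have "(cover t :: circle) = cover s" by (simp add: cover_circle_eq_iff)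
    then show "t \<in> cover -` (cover ` S :: circle set)" using \<open>s \<in> S\<close> by auto
  qed
  then show "open (cover ` S :: circle set)"
    using S by (subst open_iff_open_vimage_cover) (auto intro!: open_UN open_translation)
next
  fix s t :: real assume st: "(cover s :: circle) = cover t" "\<bar>s - t\<bar> < 1"
  then obtain n where "s - t = of_int n" by (auto simp: cover_circle_eq_iff elim: Ints_cases)
  moreover from this st(2) have "n = 0" by linarith
  ultimately show "s = t" by simp
qed

lemma continuous_on_cover: "continuous_on A (cover :: real \<Rightarrow> 'a::coordinate_line)"
proof -
  have "continuous_on UNIV (cover :: real \<Rightarrow> 'a)"
    unfolding continuous_on_open_vimage[OF open_UNIV]
  proof (intro allI impI)
    fix B :: "'a set" assume "open B"
    then have "open (cover -` B)" by (rule iffD1[OF open_iff_open_vimage_cover])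
    then show "open (cover -` B \<inter> UNIV)" by (simp only: Int_UNIV_right)
  qed
  then show ?thesis by (rule continuous_on_subset) simp
qed

lemma continuous_on_cover2: "continuous_on A (cover2 :: _ \<Rightarrow> 'a::coordinate_line \<times> real)"
  unfolding cover2_def
  by (intro continuous_intros continuous_on_compose2[OF continuous_on_cover[of UNIV]]) auto

lemma open_vimage_cover2: "open U \<Longrightarrow> open (cover2 -` U)"
  by (rule open_vimage[OF _ continuous_on_cover2])

lemma surj_cover2: "surj (cover2 :: _ \<Rightarrow> 'a::coordinate_line \<times> real)"
  unfolding surj_def
proof
  fix p :: "'a \<times> real"
  obtain x where "cover x = fst p" using surj_cover[where 'a='a] by (metis surjD)
  then show "\<exists>z. p = cover2 z" by (intro exI[of _ "(x, snd p)"]) (simp add: cover2_def)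
qed

lemma open_cover2_image:
  assumes "open S"
  shows "open (cover2 ` S :: ('a::line_cover \<times> real) set)"
proof (rule Topological_Spaces.openI)
  fix p :: "'a \<times> real" assume "p \<in> cover2 ` S"
  then obtain z where z: "z \<in> S" "p = cover2 z" by auto
  then obtain A B where AB: "open A" "open B" "z \<in> A \<times> B" "A \<times> B \<subseteq> S"
    using open_prod_elim[OF assms] by metis
  show "\<exists>T. open T \<and> p \<in> T \<and> T \<subseteq> cover2 ` S"
  proof (intro exI[of _ "cover ` A \<times> B"] conjI)
    show "open (cover ` A \<times> B :: ('a \<times> real) set)" using AB by (intro open_Times open_cover_image)
    show "p \<in> cover ` A \<times> B" using z AB by (auto simp: cover2_def)
    show "cover ` A \<times> B \<subseteq> (cover2 ` S :: ('a \<times> real) set)"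
    proof
      fix q :: "'a \<times> real" assume "q \<in> cover ` A \<times> B"
      then obtain x y where "x \<in> A" "y \<in> B" "q = cover2 (x, y)" by (auto simp: cover2_def)
      then show "q \<in> cover2 ` S" using AB(4) by blast
    qed
  qed
qed

text \<open>A strip of width \<open>1\<close> on which \<open>cover2\<close> is injective.  Near a point, maps into the annulus are lifted by
  composing them with the inverse of \<open>cover2\<close> on one sheet, and the same sheet serves all the
  late maps of a convergent sequence.\<close>

definition sheet :: "real \<Rightarrow> (real \<times> real) set" where
  "sheet x = {x - 1/2<..<x + 1/2} \<times> UNIV"

definition sheet_section :: "real \<Rightarrow> 'a::line_cover \<times> real \<Rightarrow> real \<times> real" where
  "sheet_section x = inv_into (sheet x) cover2"

lemma open_sheet: "open (sheet x)"
  unfolding sheet_def by (intro open_Times) auto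

lemma inj_on_cover2_sheet: "inj_on (cover2 :: _ \<Rightarrow> 'a::line_cover \<times> real) (sheet x)"
proof (rule inj_onI)
  fix v w assume vw: "v \<in> sheet x" "w \<in> sheet x" "(cover2 v :: 'a \<times> real) = cover2 w"
  then have "(cover (fst v) :: 'a) = cover (fst w)" "\<bar>fst v - fst w\<bar> < 1" "snd v = snd w"
    by (auto simp: sheet_def cover2_def)
  then show "v = w" using cover_locally_injective by (simp add: prod_eq_iff)
qed

lemma sheet_section_cover2: "z \<in> sheet x \<Longrightarrow> sheet_section x (cover2 z :: 'a::line_cover \<times> real) = z"
  unfolding sheet_section_def by (rule inv_into_f_f[OF inj_on_cover2_sheet])

lemma cover2_sheet_section: "p \<in> cover2 ` sheet x \<Longrightarrow> cover2 (sheet_section x p) = p"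
  unfolding sheet_section_def by (rule f_inv_into_f)

lemma sheet_section_in_sheet: "p \<in> cover2 ` sheet x \<Longrightarrow> sheet_section x p \<in> sheet x"
  unfolding sheet_section_def by (rule inv_into_into)

lemma continuous_on_sheet_section:
  "continuous_on (cover2 ` sheet x) (sheet_section x :: 'a::line_cover \<times> real \<Rightarrow> _)"
  unfolding continuous_on_open_vimage[OF open_cover2_image[OF open_sheet]]
proof (intro allI impI)
  fix B :: "(real \<times> real) set" assume B: "open B"
  have "sheet_section x -` B \<inter> cover2 ` sheet x = (cover2 ` (B \<inter> sheet x) :: ('a \<times> real) set)"
    by (auto simp: sheet_section_cover2)
  then show "open (sheet_section x -` B \<inter> cover2 ` sheet x :: ('a \<times> real) set)"
    using B by (simp add: open_cover2_image open_sheet open_Int)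
qed

lemma compact_open_limitD:
  assumes "limitin (compact_open_topology U) \<phi> \<Phi> sequentially" "continuous_on U \<Phi>"
    and "compact K" "K \<subseteq> U" "open G" "\<Phi> ` K \<subseteq> G"
  shows "\<forall>\<^sub>F n in sequentially. \<phi> n ` K \<subseteq> G"
proof -
  let ?O = "{f. continuous_on U f \<and> f ` K \<subseteq> G}"
  have "openin (compact_open_topology U) ?O"
    unfolding compact_open_topology_def by (rule topology_generated_by_Basis) (use assms in blast)
  then have "\<forall>\<^sub>F n in sequentially. \<phi> n \<in> ?O"
    using assms unfolding limitin_def by blast
  then show ?thesis by eventually_elim blast
qed

lemma cover2_annulus_eqD:
  assumes "(cover2 z :: annulus) = cover2 w"
  obtains m where "z = w + (m, 0)" "m \<in> \<int>"
proof (rule that)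
  show "z = w + (fst z - fst w, 0)" "fst z - fst w \<in> \<int>"
    using assms by (auto simp: cover2_def cover_circle_eq_iff prod_eq_iff)
qed

lemma cover2_annulus_shift: "m \<in> \<int> \<Longrightarrow> (cover2 (w + (m, 0)) :: annulus) = cover2 w"
  by (simp add: cover2_def cover_circle_eq_iff)

text \<open>Near \<open>z\<close> the lift through a sheet differs from a \<open>C\<^sup>1\<close> lift only by a horizontal integer
  translation, so it is \<open>C\<^sup>1\<close> too, and the primitive \<open>S\<close> applies to it.\<close>

lemma unit_det_of_exact_symplectic_lift:
  fixes \<phi> :: "'a::line_cover \<times> real \<Rightarrow> annulus"
  assumes \<phi>: "exact_symplectic_diffeo U V \<phi>"
    and W: "open W" "cover2 ` W \<subseteq> U" "\<phi> ` cover2 ` W \<subseteq> cover2 ` sheet x"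
    and z: "z \<in> W"
  defines "F \<equiv> \<lambda>w. sheet_section x (\<phi> (cover2 w))"
  shows "\<exists>F'. (F has_derivative F') (at z) \<and>
    fst (F' (1, 0)) * snd (F' (0, 1)) - fst (F' (0, 1)) * snd (F' (1, 0)) = 1"
proof -
  have cont\<phi>: "continuous_on U \<phi>"
    using \<phi> unfolding exact_symplectic_diffeo_def C1_diffeomorphism_def homeomorphism_def by blast
  have contF: "continuous_on W F"
    unfolding F_def
    by (rule continuous_on_compose2[OF continuous_on_sheet_section
          continuous_on_compose2[OF cont\<phi> continuous_on_cover2]]) (use W in auto)
  have cF: "cover2 (F w) = \<phi> (cover2 w)" if "w \<in> W" for w
    unfolding F_def by (rule cover2_sheet_section) (use W that in auto)
  have Fsheet: "F w \<in> sheet x" if "w \<in> W" for w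
    unfolding F_def by (rule sheet_section_in_sheet) (use W that in auto)
  have "local_lift U \<phi> W F"
    using W contF cF by (auto simp: local_lift_def)
  note lift = this
  have "exact_symplectic_on U \<phi>" using \<phi> unfolding exact_symplectic_diffeo_def by (rule conjunct2)
  then obtain S :: "'a \<times> real \<Rightarrow> real" where S: "\<forall>W F. local_lift U \<phi> W F \<longrightarrow> (\<forall>w\<in>W. ((S \<circ> cover2) has_derivative
        (\<lambda>h. snd (F w) * fst (frechet_derivative F (at w) h) - snd w * fst h)) (at w))"
    unfolding exact_symplectic_on_def by blast
  note S = S[rule_format, OF lift]
  have "C1_map_on U \<phi>" using \<phi> unfolding exact_symplectic_diffeo_def C1_diffeomorphism_def by blast
  then obtain W' G where G: "z \<in> W'" "local_lift U \<phi> W' G" "C1_on W' G"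
    using z W(2) unfolding C1_map_on_def by blast
  then obtain G' where G': "\<And>w. w \<in> W' \<Longrightarrow> (G has_derivative blinfun_apply (G' w)) (at w)" "continuous_on W' G'"
    unfolding C1_on_def by blast
  have W': "open W'" "continuous_on W' G" "\<And>w. w \<in> W' \<Longrightarrow> cover2 (G w) = \<phi> (cover2 w)"
    using G(2) by (auto simp: local_lift_def)
  have "(cover2 (F z) :: annulus) = cover2 (G z)" using cF[OF z] W'(3)[OF G(1)] by simp
  then obtain m where m: "F z = G z + (m, 0)" "m \<in> \<int>" by (rule cover2_annulus_eqD)
  \<comment> \<open>The translate \<open>H\<close> of the given \<open>C\<^sup>1\<close> lift agrees with \<open>F\<close> at \<open>z\<close>, hence in the same sheet nearby.\<close>
  define H where "H w = G w + (m, 0)" for w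
  have contH: "continuous_on W' H" unfolding H_def by (intro continuous_intros W'(2))
  define N where "N = W \<inter> (H -` sheet x \<inter> W')"
  have "open (H -` sheet x \<inter> W')"
    using contH open_sheet continuous_on_open_vimage[OF W'(1)] by blast
  then have N: "open N" unfolding N_def by (rule open_Int[OF W(1)])
  have zN: "z \<in> N" using z G(1) m(1) Fsheet[OF z] by (simp add: N_def H_def)
  have FH: "F w = H w" if "w \<in> N" for w
  proof -
    have "\<phi> (cover2 w) = cover2 (H w)"
      using that W'(3) m(2) by (simp add: N_def H_def cover2_annulus_shift)
    then show ?thesis using that by (simp add: F_def N_def sheet_section_cover2)
  qed
  have F': "(F has_derivative blinfun_apply (G' w)) (at w)" if w: "w \<in> N" for w
  proof (rule has_derivative_transform_within_open[OF _ N w])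
    show "(H has_derivative blinfun_apply (G' w)) (at w)"
    proof -
      have "w \<in> W'" using w by (simp add: N_def)
      from has_derivative_add[OF G'(1)[OF this] has_derivative_const[of "(m, 0)"]]
      show ?thesis unfolding H_def by simp
    qed
  qed (simp add: FH)
  have "((S \<circ> cover2) has_derivative (\<lambda>h. snd (F w) * fst (G' w h) - snd w * fst h)) (at w)" if w: "w \<in> N" for w
  proof -
    have "w \<in> W" using w by (simp add: N_def)
    from S[OF this] show ?thesis unfolding frechet_derivative_at[OF F'[OF w], symmetric] .
  qed
  note dS = this
  have "fst (G' z (1, 0)) * snd (G' z (0, 1)) - fst (G' z (0, 1)) * snd (G' z (1, 0)) = 1"
  proof (rule det_eq_1_of_exact[OF N zN F' _ dS])
    show "continuous_on N G'" by (rule continuous_on_subset[OF G'(2)]) (auto simp: N_def)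
  qed
  with F'[OF zN] show ?thesis by blast
qed

text \<open>On a small ball the maps of the approximating sequence eventually take values in the sheet that
  contains the lifted image point, and there all of them lift together with \<open>\<Phi>\<close>.\<close>

lemma area_preserving_lift_of_exact_symplectic_homeo:
  fixes \<Phi> :: "'a::line_cover \<times> real \<Rightarrow> annulus"
  assumes \<Phi>: "exact_symplectic_homeo U V \<Phi>"
    and z0: "cover2 z0 \<in> U" "cover2 p = \<Phi> (cover2 z0)"
  obtains W F where "open W" "convex W" "z0 \<in> W" "cover2 ` W \<subseteq> U"
    "continuous_on W F" "inj_on F W" "F z0 = p" "\<And>w. w \<in> W \<Longrightarrow> cover2 (F w) = \<Phi> (cover2 w)"
    "\<And>K. compact K \<Longrightarrow> K \<subseteq> W \<Longrightarrow> emeasure lborel K \<le> emeasure lborel (F ` K) \<and>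
       emeasure lborel (interior (F ` K)) \<le> emeasure lborel K"
proof -
  have U: "open U" and cont\<Phi>: "continuous_on U \<Phi>" and inj\<Phi>: "inj_on \<Phi> U"
    using \<Phi> unfolding exact_symplectic_homeo_def homeomorphism_def by (auto intro: inj_on_inverseI)
  obtain \<phi> where \<phi>: "\<And>n. exact_symplectic_diffeo U (\<phi> n ` U) (\<phi> n)"
    and lim: "limitin (compact_open_topology U) \<phi> \<Phi> sequentially"
    using \<Phi> unfolding exact_symplectic_homeo_def by blast
  define x where "x = fst p"
  have pS: "p \<in> sheet x" by (simp add: x_def sheet_def mem_Times_iff)
  have tgt: "open (cover2 ` sheet x :: annulus set)" by (intro open_cover2_image open_sheet)
  define M where "M = cover2 -` (\<Phi> -` (cover2 ` sheet x) \<inter> U) \<inter> sheet (fst z0)"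
  have "open (\<Phi> -` (cover2 ` sheet x) \<inter> U)"
    using tgt cont\<Phi> continuous_on_open_vimage[OF U] by blast
  then have "open M" unfolding M_def by (rule open_Int[OF open_vimage_cover2 open_sheet])
  moreover have "z0 \<in> M"
    using z0 pS by (auto simp: M_def sheet_def mem_Times_iff intro!: image_eqI[of _ _ p])
  ultimately obtain r where r: "r > 0" "cball z0 r \<subseteq> M" by (meson open_contains_cball)
  define W where "W = ball z0 r"
  have WM: "W \<subseteq> M" using r by (auto simp: W_def)
  define lift where "lift f w = sheet_section x (f (cover2 w))" for f :: "'a \<times> real \<Rightarrow> annulus" and w
  have inj2: "inj_on (cover2 :: _ \<Rightarrow> 'a \<times> real) M"
    by (rule inj_on_subset[OF inj_on_cover2_sheet]) (auto simp: M_def)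
  have MU: "cover2 ` M \<subseteq> U" by (auto simp: M_def)
  have cont: "continuous_on A (lift f)"
    if "continuous_on U f" "cover2 ` A \<subseteq> U" "f ` cover2 ` A \<subseteq> cover2 ` sheet x" for f A
    unfolding lift_def
    by (rule continuous_on_compose2[OF continuous_on_sheet_section
          continuous_on_compose2[OF that(1) continuous_on_cover2]]) (use that in auto)
  have inj: "inj_on (lift f) A"
    if "inj_on f U" "A \<subseteq> M" "f ` cover2 ` A \<subseteq> cover2 ` sheet x" for f A
  proof (rule inj_onI)
    fix v w assume vw: "v \<in> A" "w \<in> A" "lift f v = lift f w"
    then have "f (cover2 v) \<in> cover2 ` sheet x" "f (cover2 w) \<in> cover2 ` sheet x"
      using that(3) by blast+
    then have "f (cover2 v) = cover2 (lift f v)" "f (cover2 w) = cover2 (lift f w)"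
      unfolding lift_def by (simp_all only: cover2_sheet_section)
    then have "f (cover2 v) = f (cover2 w)" using vw(3) by simp
    then have "(cover2 v :: 'a \<times> real) = cover2 w"
      using that(1,2) MU vw by (meson imageI inj_onD subsetD)
    then show "v = w" using inj2 that(2) vw by (meson inj_onD subsetD)
  qed
  have \<Phi>M: "\<Phi> ` cover2 ` M \<subseteq> cover2 ` sheet x" by (auto simp: M_def)
  have ev: "\<forall>\<^sub>F n in sequentially. \<phi> n ` cover2 ` cball z0 r \<subseteq> cover2 ` sheet x"
  proof (rule compact_open_limitD[OF lim cont\<Phi> _ _ tgt])
    show "compact (cover2 ` cball z0 r :: ('a \<times> real) set)"
      by (rule compact_continuous_image[OF continuous_on_cover2 compact_cball])
  qed (use r \<Phi>M MU in blast)+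
  show thesis
  proof (rule that)
    show "open W" "convex W" "z0 \<in> W" using r by (auto simp: W_def)
    show "cover2 ` W \<subseteq> U" using WM MU by blast
    show contL: "continuous_on W (lift \<Phi>)" by (rule cont[OF cont\<Phi>]) (use WM MU \<Phi>M in blast)+
    show injL: "inj_on (lift \<Phi>) W" by (rule inj[OF inj\<Phi> WM]) (use WM \<Phi>M in blast)
    show "lift \<Phi> z0 = p" using pS by (simp add: lift_def z0(2)[symmetric] sheet_section_cover2)
    show "cover2 (lift \<Phi> w) = \<Phi> (cover2 w)" if "w \<in> W" for w
      unfolding lift_def by (rule cover2_sheet_section) (use that WM \<Phi>M in blast)
    fix K assume K: "compact K" "K \<subseteq> W"
    have area: "\<forall>\<^sub>F n in sequentially. continuous_on K (lift (\<phi> n)) \<and> emeasure lborel (lift (\<phi> n) ` K) = emeasure lborel K"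
      using ev
    proof eventually_elim
      case (elim n)
      have cont\<phi>: "continuous_on U (\<phi> n)" and inj\<phi>: "inj_on (\<phi> n) U"
        using \<phi>[of n] unfolding exact_symplectic_diffeo_def C1_diffeomorphism_def homeomorphism_def
        by (auto intro: inj_on_inverseI)
      have W: "\<phi> n ` cover2 ` W \<subseteq> cover2 ` sheet x" using elim ball_subset_cball unfolding W_def by blast
      have "\<exists>F'. (lift (\<phi> n) has_derivative F') (at z) \<and>
          fst (F' (1, 0)) * snd (F' (0, 1)) - fst (F' (0, 1)) * snd (F' (1, 0)) = 1" if "z \<in> W" for z
        unfolding lift_def
      proof (rule unit_det_of_exact_symplectic_lift[OF \<phi>[of n] _ _ W that])
        show "open W" by (simp add: W_def)
        show "cover2 ` W \<subseteq> U" using WM MU by blast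
      qed
      then obtain F' where F': "\<And>z. z \<in> W \<Longrightarrow> (lift (\<phi> n) has_derivative F' z) (at z) \<and>
          fst (F' z (1, 0)) * snd (F' z (0, 1)) - fst (F' z (0, 1)) * snd (F' z (1, 0)) = 1" by metis
      have "emeasure lborel (lift (\<phi> n) ` K) = emeasure lborel K"
      proof (rule emeasure_image_unit_det[where F'=F', OF K(1)])
        show "inj_on (lift (\<phi> n)) K" by (rule inj[OF inj\<phi>]) (use K WM W in blast)+
        fix z assume "z \<in> K"
        then have "z \<in> W" using K(2) by blast
        from F'[OF this] show "(lift (\<phi> n) has_derivative F' z) (at z)"
          "\<bar>fst (F' z (1, 0)) * snd (F' z (0, 1)) - fst (F' z (0, 1)) * snd (F' z (1, 0))\<bar> = 1"
          by simp_all
      qed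
      moreover have "continuous_on K (lift (\<phi> n))" by (rule cont[OF cont\<phi>]) (use K WM MU W in blast)+
      ultimately show ?case by simp
    qed
    have conv: "\<forall>\<^sub>F n in sequentially. lift (\<phi> n) ` C \<subseteq> G"
      if C: "compact C" "C \<subseteq> K" and G: "open G" "lift \<Phi> ` C \<subseteq> G" for C G
    proof -
      have CM: "C \<subseteq> M" using C K WM by blast
      have "\<forall>\<^sub>F n in sequentially. \<phi> n ` cover2 ` C \<subseteq> cover2 ` (G \<inter> sheet x)"
      proof (rule compact_open_limitD[OF lim cont\<Phi>])
        show "\<Phi> ` cover2 ` C \<subseteq> cover2 ` (G \<inter> sheet x)"
        proof (unfold image_image, rule image_subsetI)
          fix w assume w: "w \<in> C"
          then have "\<Phi> (cover2 w) \<in> cover2 ` sheet x" using CM \<Phi>M by blast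
          then have "\<Phi> (cover2 w) = cover2 (lift \<Phi> w)" "lift \<Phi> w \<in> sheet x"
            by (simp_all add: lift_def cover2_sheet_section sheet_section_in_sheet)
          then show "\<Phi> (cover2 w) \<in> cover2 ` (G \<inter> sheet x)" using G(2) w by blast
        qed
        show "compact (cover2 ` C :: ('a \<times> real) set)"
          by (rule compact_continuous_image[OF continuous_on_cover2 C(1)])
        show "cover2 ` C \<subseteq> U" using CM MU by blast
        show "open (cover2 ` (G \<inter> sheet x) :: annulus set)"
          by (intro open_cover2_image open_Int G(1) open_sheet)
      qed
      then show ?thesis
      proof eventually_elim
        case (elim n)
        show ?case
        proof (rule image_subsetI)
          fix w assume "w \<in> C"
          then obtain g where "g \<in> G" "g \<in> sheet x" "\<phi> n (cover2 w) = cover2 g" using elim by blast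
          then show "lift (\<phi> n) w \<in> G" by (simp add: lift_def sheet_section_cover2)
        qed
      qed
    qed
    show "emeasure lborel K \<le> emeasure lborel (lift \<Phi> ` K) \<and>
       emeasure lborel (interior (lift \<Phi> ` K)) \<le> emeasure lborel K"
      by (intro conjI area_comparison_in_limit[where fs="\<lambda>n. lift (\<phi> n)", OF K(1)
            continuous_on_subset[OF contL K(2)] inj_on_subset[OF injL K(2)] area conv])
  qed
qed

section \<open>Foliations by graphs\<close>

lemma cos_turn_cover [simp]: "cos_turn (cover t) = cos (2 * pi * t)"
  unfolding cover_circle_def by (rule cos_turn.abs_eq)

lemma sin_turn_cover [simp]: "sin_turn (cover t) = sin (2 * pi * t)"
  unfolding cover_circle_def by (rule sin_turn.abs_eq)

lemma continuous_on_circleI: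
  fixes f :: "circle \<Rightarrow> 'b::topological_space"
  assumes "continuous_on UNIV (\<lambda>t. f (cover t))"
  shows "continuous_on A f"
proof -
  have "continuous_on UNIV f"
    unfolding continuous_on_open_vimage[OF open_UNIV]
  proof (intro allI impI)
    fix B :: "'b set" assume "open B"
    then have "open ((\<lambda>t. f (cover t)) -` B)" using assms by (rule open_vimage)
    then have "open (cover -` (f -` B) :: real set)" by (simp add: vimage_def)
    then have "open (f -` B)" by (rule iffD2[OF open_iff_open_vimage_cover])
    then show "open (f -` B \<inter> UNIV)" by simp
  qed
  then show ?thesis by (rule continuous_on_subset) simp
qed

lemma continuous_on_cos_turn: "continuous_on A cos_turn"
  by (rule continuous_on_circleI) (auto intro!: continuous_intros)

lemma continuous_on_sin_turn: "continuous_on A sin_turn"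
  by (rule continuous_on_circleI) (auto intro!: continuous_intros)

lemma cover_surjE:
  fixes \<theta> :: "'a::coordinate_line"
  obtains t where "\<theta> = cover t"
  using surj_cover by (metis surjD)

lemma abs_cos_turn_le_one: "\<bar>cos_turn \<theta>\<bar> \<le> 1"
  by (cases \<theta> rule: cover_surjE) simp

text \<open>Quantitative injectivity of the height along a vertical line; it makes the inverse of the
  foliation chart continuous.\<close>

lemma (in slow_lipschitz) height_expanding:
  assumes "\<bar>w\<bar> \<le> 1"
  shows "\<bar>k2 - k1\<bar> \<le> 2 * \<bar>(k2 + \<epsilon> k2 * w) - (k1 + \<epsilon> k1 * w)\<bar>"
proof -
  have "\<bar>(\<epsilon> k2 - \<epsilon> k1) * w\<bar> \<le> \<bar>k2 - k1\<bar> / 2"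
    using mult_mono[OF slow_half[of k2 k1] assms] by (simp add: abs_mult)
  moreover have "\<bar>k2 - k1\<bar> \<le> \<bar>(k2 + \<epsilon> k2 * w) - (k1 + \<epsilon> k1 * w)\<bar> + \<bar>(\<epsilon> k2 - \<epsilon> k1) * w\<bar>"
    using abs_triangle_ineq4[of "(k2 + \<epsilon> k2 * w) - (k1 + \<epsilon> k1 * w)" "(\<epsilon> k2 - \<epsilon> k1) * w"]
    by (simp add: algebra_simps)
  ultimately show ?thesis by simp
qed

lemma (in slow_lipschitz) height_surjective:
  assumes "\<bar>w\<bar> \<le> 1"
  shows "\<exists>k. k + \<epsilon> k * w = y"
proof -
  define R where "R = 2 * \<bar>y - \<epsilon> 0 * w\<bar>"
  have grow: "\<epsilon> k * w \<le> \<epsilon> 0 * w + \<bar>k\<bar> / 2" "\<epsilon> 0 * w - \<bar>k\<bar> / 2 \<le> \<epsilon> k * w" for k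
  proof -
    have "\<bar>\<epsilon> k * w - \<epsilon> 0 * w\<bar> \<le> \<bar>k\<bar> / 2"
      using mult_mono[OF slow_half[of k 0] assms] by (simp add: abs_mult flip: left_diff_distrib)
    then show "\<epsilon> k * w \<le> \<epsilon> 0 * w + \<bar>k\<bar> / 2" "\<epsilon> 0 * w - \<bar>k\<bar> / 2 \<le> \<epsilon> k * w"
      unfolding abs_le_iff by linarith+
  qed
  have "\<exists>k\<ge>-R. k \<le> R \<and> k + \<epsilon> k * w = y"
  proof (rule IVT')
    have R: "R \<ge> 0" "2 * (y - \<epsilon> 0 * w) \<le> R" "- R \<le> 2 * (y - \<epsilon> 0 * w)"
      using abs_ge_self[of "y - \<epsilon> 0 * w"] abs_ge_minus_self[of "y - \<epsilon> 0 * w"] by (simp_all add: R_def)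
    then show "- R + \<epsilon> (- R) * w \<le> y" "y \<le> R + \<epsilon> R * w" "- R \<le> R"
      using grow(1)[of "-R"] grow(2)[of R] by simp_all
    show "continuous_on {- R..R} (\<lambda>k. k + \<epsilon> k * w)" by (intro continuous_intros continuous_eps)
  qed
  then show ?thesis by blast
qed

text \<open>The chart is bijective because heights increase to infinity along each vertical line.  Its inverse is
  continuous by comparing, on the vertical line through \<open>q\<close>, the leaf of \<open>q\<close> with the leaf of \<open>p\<close>.\<close>

lemma (in slow_lipschitz) continuous_graph_foliation_of_heights:
  "continuous_graph_foliation (range (\<lambda>c. leaf_of (\<lambda>\<theta>. c + \<epsilon> c * cos_turn \<theta>)))"
proof -
  define h where "h = (\<lambda>(\<theta>, c). (\<theta> :: circle, c + \<epsilon> c * cos_turn \<theta>))"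
  have bij: "bij h"
  proof (rule bijI)
    show "inj h"
      by (rule injI) (auto simp: h_def height_eq_iff abs_cos_turn_le_one)
    show "surj h"
      unfolding surj_def
    proof
      fix p :: annulus
      obtain k where "k + \<epsilon> k * cos_turn (fst p) = snd p"
        using height_surjective[OF abs_cos_turn_le_one] by blast
      then show "\<exists>q. p = h q" by (intro exI[of _ "(fst p, k)"]) (simp add: h_def prod_eq_iff)
    qed
  qed
  have conth: "continuous_on UNIV h"
    unfolding h_def case_prod_beta
    by (intro continuous_intros continuous_on_compose2[OF continuous_on_cos_turn[of UNIV]]
          continuous_on_compose2[OF continuous_eps[of UNIV]]) auto
  define g where "g = inv h"
  have hg: "h (g p) = p" and gh: "g (h q) = q" for p q
    using bij by (auto simp: g_def bij_is_surj bij_is_inj surj_f_inv_f inv_f_f)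
  have g1: "fst (g p) = fst p" for p
    using hg[of p] by (auto simp: h_def prod_eq_iff case_prod_beta)
  have g2: "snd (g p) + \<epsilon> (snd (g p)) * cos_turn (fst p) = snd p" for p
    using hg[of p] g1[of p] by (auto simp: h_def prod_eq_iff case_prod_beta)
  have "continuous_on UNIV (\<lambda>p. snd (g p))"
    unfolding continuous_on_def
  proof (intro ballI)
    fix p :: annulus
    have "((\<lambda>q. 2 * \<bar>snd q - snd p - \<epsilon> (snd (g p)) * (cos_turn (fst q) - cos_turn (fst p))\<bar>) \<longlongrightarrow>
        2 * \<bar>snd p - snd p - \<epsilon> (snd (g p)) * (cos_turn (fst p) - cos_turn (fst p))\<bar>) (at p)"
    proof (intro tendsto_intros)
      have "continuous_on UNIV (\<lambda>q :: annulus. cos_turn (fst q))"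
        by (rule continuous_on_compose2[OF continuous_on_cos_turn[of UNIV]]) (auto intro!: continuous_intros)
      then show "((\<lambda>q. cos_turn (fst q)) \<longlongrightarrow> cos_turn (fst p)) (at p)"
        unfolding continuous_on_def by (rule bspec) simp
    qed
    then have lim: "((\<lambda>q. 2 * \<bar>snd q - snd p - \<epsilon> (snd (g p)) * (cos_turn (fst q) - cos_turn (fst p))\<bar>) \<longlongrightarrow> 0) (at p)"
      by simp
    have "norm (snd (g q) - snd (g p)) \<le>
        2 * \<bar>snd q - snd p - \<epsilon> (snd (g p)) * (cos_turn (fst q) - cos_turn (fst p))\<bar>" for q
    proof -
      have "(snd (g q) + \<epsilon> (snd (g q)) * cos_turn (fst q)) - (snd (g p) + \<epsilon> (snd (g p)) * cos_turn (fst q))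
          = snd q - snd p - \<epsilon> (snd (g p)) * (cos_turn (fst q) - cos_turn (fst p))"
        using g2[of p] g2[of q] by (simp add: algebra_simps)
      then show ?thesis
        using height_expanding[OF abs_cos_turn_le_one, of "snd (g q)" "snd (g p)" "fst q"] by simp
    qed
    then have "((\<lambda>q. snd (g q) - snd (g p)) \<longlongrightarrow> 0) (at p)"
      by (intro Lim_null_comparison[OF _ lim] always_eventually) auto
    then show "((\<lambda>q. snd (g q)) \<longlongrightarrow> snd (g p)) (at p within UNIV)"
      by (simp add: LIM_zero_iff)
  qed
  then have "continuous_on UNIV (\<lambda>p. (fst p, snd (g p)))"
    by (rule continuous_on_Pair[OF continuous_on_fst[OF continuous_on_id]])
  then have contg: "continuous_on UNIV g"
    by (rule continuous_on_eq) (simp add: prod_eq_iff g1)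
  have "homeomorphism UNIV UNIV h g"
    using conth contg hg gh surjI[of h g, OF hg] surjI[of g h, OF gh] by (simp add: homeomorphism_def)
  then show ?thesis
    unfolding continuous_graph_foliation_def h_def
    by (intro exI[of _ "\<lambda>c \<theta>. c + \<epsilon> c * cos_turn \<theta>"]) auto
qed

lemma (in slow_lipschitz) generating_function_of_heights:
  "generating_function (range (\<lambda>c. leaf_of (\<lambda>\<theta>. c + \<epsilon> c * cos_turn \<theta>)))
     (\<lambda>(\<theta>, c). \<epsilon> c / (2 * pi) * sin_turn \<theta>)"
  unfolding generating_function_def
proof (intro conjI allI)
  show "continuous_on UNIV (\<lambda>(\<theta>, c). \<epsilon> c / (2 * pi) * sin_turn \<theta>)"
    unfolding case_prod_beta
    by (intro continuous_intros continuous_on_compose2[OF continuous_on_sin_turn[of UNIV]]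
          continuous_on_compose2[OF continuous_eps[of UNIV]]) auto
  fix c
  show "(case (cover 0, c) of (\<theta>, c) \<Rightarrow> \<epsilon> c / (2 * pi) * sin_turn \<theta>) = 0" by simp
  show "\<exists>D. continuous_on UNIV D \<and>
      (\<forall>t. ((\<lambda>s. case (cover s, c) of (\<theta>, c) \<Rightarrow> \<epsilon> c / (2 * pi) * sin_turn \<theta>) has_real_derivative D (cover t)) (at t)) \<and>
      leaf_of (\<lambda>\<theta>. c + D \<theta>) \<in> range (\<lambda>c. leaf_of (\<lambda>\<theta>. c + \<epsilon> c * cos_turn \<theta>))"
    by (intro exI[of _ "\<lambda>\<theta>. \<epsilon> c * cos_turn \<theta>"])
       (auto intro!: continuous_intros continuous_on_cos_turn derivative_eq_intros)
qed

lemma C1_function_on_generating: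
  fixes \<epsilon> D :: "real \<Rightarrow> real"
  assumes der: "\<And>l. l \<in> {a<..<b} \<Longrightarrow> (\<epsilon> has_real_derivative D l) (at l)"
    and cont: "continuous_on {a<..<b} D"
  shows "C1_function_on (UNIV \<times> {a<..<b}) (\<lambda>(\<theta>, c). \<epsilon> c / (2 * pi) * sin_turn \<theta>)"
proof -
  let ?W = "UNIV \<times> {a<..<b} :: (real \<times> real) set"
  define F' :: "real \<times> real \<Rightarrow> (real \<times> real) \<Rightarrow>\<^sub>L real" where
    "F' z = (\<epsilon> (snd z) * cos (2 * pi * fst z)) *\<^sub>R Blinfun fst + (D (snd z) / (2 * pi) * sin (2 * pi * fst z)) *\<^sub>R Blinfun snd" for z
  have conte: "continuous_on {a<..<b} \<epsilon>"
    using der by (meson DERIV_isCont continuous_at_imp_continuous_on)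
  have der': "((\<lambda>z. \<epsilon> (snd z) / (2 * pi) * sin (2 * pi * fst z)) has_derivative blinfun_apply (F' z)) (at z)"
    if "z \<in> ?W" for z
  proof -
    have "((\<lambda>z. \<epsilon> (snd z)) has_derivative (\<lambda>h. D (snd z) * snd h)) (at z)"
      by (rule has_derivative_compose[OF has_derivative_snd[OF has_derivative_ident]])
         (use der[of "snd z"] that in \<open>auto simp: has_field_derivative_def\<close>)
    then show ?thesis
      by (auto intro!: derivative_eq_intros ext
          simp: F'_def blinfun.bilinear_simps bounded_linear_Blinfun_apply bounded_linear_fst bounded_linear_snd field_simps)
  qed
  have contF': "continuous_on ?W F'"
    unfolding F'_def
    by (intro continuous_intros continuous_on_compose2[OF conte] continuous_on_compose2[OF cont]) auto
  have vimage: "cover2 -` (UNIV \<times> {a<..<b}) = ?W" by (auto simp: cover2_def)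
  have comp: "(\<lambda>(\<theta>, c). \<epsilon> c / (2 * pi) * sin_turn \<theta>) \<circ> cover2 = (\<lambda>z. \<epsilon> (snd z) / (2 * pi) * sin (2 * pi * fst z))"
    by (auto simp: cover2_def)
  show ?thesis
    unfolding C1_function_on_def C1_on_def vimage comp
    by (intro exI[of _ F'] conjI ballI der' contF')
qed

text \<open>Leaves of a restricted foliation are connected components, so a connected piece of a leaf or of a
  horizontal line inside the domain lies in one leaf and is mapped into one leaf.  This gives the two
  leafwise hypotheses of \<open>strict_derivative_of_plane_straightening\<close>.\<close>

theorem (in slow_lipschitz) straightening_imp_C1:
  fixes \<Phi> :: "'a::line_cover \<times> real \<Rightarrow> annulus"
  assumes \<Phi>: "straightens_oriented U V (range (\<lambda>c. leaf_of (\<lambda>\<theta>. c + \<epsilon> c * cos_turn \<theta>))) \<Phi>"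
    and P: "(\<theta>0, c0 + \<epsilon> c0 * cos_turn \<theta>0) \<in> V"
  obtains d D where "d > 0" "\<And>l. l \<in> {c0-d<..<c0+d} \<Longrightarrow> (\<epsilon> has_real_derivative D l) (at l)"
    "continuous_on {c0-d<..<c0+d} D"
proof -
  define \<L> where "\<L> c = leaf_of (\<lambda>\<theta>. c + \<epsilon> c * cos_turn \<theta>)" for c
  have homeo: "exact_symplectic_homeo U V \<Phi>"
    and leaves: "image \<Phi> ` restrict_foliation horizontal_foliation U = restrict_foliation (range \<L>) V"
    using \<Phi> by (auto simp: straightens_oriented_def \<L>_def)
  have surj: "\<Phi> ` U = V" and inj: "inj_on \<Phi> U"
    using homeo unfolding exact_symplectic_homeo_def homeomorphism_def by (auto intro: inj_on_inverseI)
  have leaf_iff: "cover2 p \<in> \<L> k \<longleftrightarrow> p = leaf_chart \<epsilon> (fst p, k)" for p k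
    by (auto simp: \<L>_def leaf_of_def cover2_def leaf_chart_def prod_eq_iff)
  obtain x0 where x0: "\<theta>0 = cover x0" by (rule cover_surjE)
  have P': "cover2 (leaf_chart \<epsilon> (x0, c0)) \<in> V" using P by (simp add: x0 cover2_def leaf_chart_def)
  then obtain q where q: "q \<in> U" "\<Phi> q = cover2 (leaf_chart \<epsilon> (x0, c0))" using surj by (metis imageE)
  obtain z0 where z0: "q = cover2 z0" using surj_cover2 by (metis surjD)
  obtain W F where W: "open W" "convex W" "z0 \<in> W" "cover2 ` W \<subseteq> U"
    and F: "continuous_on W F" "inj_on F W" "F z0 = leaf_chart \<epsilon> (x0, c0)"
      "\<And>w. w \<in> W \<Longrightarrow> cover2 (F w) = \<Phi> (cover2 w)"
    and area: "\<And>K. compact K \<Longrightarrow> K \<subseteq> W \<Longrightarrow> emeasure lborel K \<le> emeasure lborel (F ` K) \<and>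
       emeasure lborel (interior (F ` K)) \<le> emeasure lborel K"
  proof (rule area_preserving_lift_of_exact_symplectic_homeo[OF homeo, of z0 "leaf_chart \<epsilon> (x0, c0)"])
    show "cover2 z0 \<in> U" "cover2 (leaf_chart \<epsilon> (x0, c0)) = \<Phi> (cover2 z0)" using q z0 by simp_all
  qed blast
  \<comment> \<open>A horizontal segment in \<open>W\<close> lies in one leaf of the restricted horizontal foliation, whose image is a leaf.\<close>
  have to_leaf: "\<exists>k x x'. F z = leaf_chart \<epsilon> (x, k) \<and> F z' = leaf_chart \<epsilon> (x', k)"
    if z: "z \<in> W" "z' \<in> W" "snd z = snd z'" for z z'
  proof -
    let ?seg = "cover2 ` closed_segment z z' :: ('a \<times> real) set"
    let ?H = "UNIV \<times> {snd z} :: ('a \<times> real) set"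
    have sub: "closed_segment z z' \<subseteq> W" using W(2) z by (simp add: closed_segment_subset)
    have "snd w = snd z" if w: "w \<in> closed_segment z z'" for w
    proof -
      obtain t where "w = (1 - t) *\<^sub>R z + t *\<^sub>R z'" using w unfolding in_segment by blast
      then have "snd w = (1 - t) * snd z + t * snd z'" by simp
      then show ?thesis unfolding z(3) by (simp add: left_diff_distrib)
    qed
    note height = this
    have "cover2 w \<in> ?H \<inter> U" if w: "w \<in> closed_segment z z'" for w
    proof
      show "cover2 w \<in> ?H" unfolding cover2_def height[OF w] by simp
      show "cover2 w \<in> U" using sub w W(4) by blast
    qed
    then have seg: "?seg \<subseteq> ?H \<inter> U" by blast
    have ne: "?H \<inter> U \<noteq> {}" using seg ends_in_segment(1)[of z z'] by blast
    have "connected ?seg" by (intro connected_continuous_image continuous_on_cover2 connected_segment)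
    from exists_component_superset[OF seg ne this]
    obtain X where X: "X \<in> components (?H \<inter> U)" "?seg \<subseteq> X" by blast
    then have "X \<in> restrict_foliation horizontal_foliation U"
      by (auto simp: restrict_foliation_def horizontal_foliation_def)
    then have "\<Phi> ` X \<in> restrict_foliation (range \<L>) V"
      unfolding leaves[symmetric] by (rule imageI)
    then obtain k where "\<Phi> ` X \<in> components (\<L> k \<inter> V)"
      unfolding restrict_foliation_def by blast
    then have "\<Phi> ` X \<subseteq> \<L> k" using in_components_subset by blast
    then have "\<Phi> (cover2 z) \<in> \<L> k" "\<Phi> (cover2 z') \<in> \<L> k" using X(2) by auto
    then have "F z = leaf_chart \<epsilon> (fst (F z), k)" "F z' = leaf_chart \<epsilon> (fst (F z'), k)"
      unfolding F(4)[OF z(1), symmetric] F(4)[OF z(2), symmetric] leaf_iff .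
    then show ?thesis by blast
  qed
  \<comment> \<open>An arc of a leaf inside the image lies in one component, which is the image of a piece of a horizontal line.\<close>
  have to_line: "snd z = snd z'"
    if z: "z \<in> W" "z' \<in> W" "F z = leaf_chart \<epsilon> (x, k)" "F z' = leaf_chart \<epsilon> (x', k)"
      and arc: "leaf_chart \<epsilon> ` (closed_segment x x' \<times> {k}) \<subseteq> F ` W" for z z' k x x'
  proof -
    let ?arc = "cover2 ` leaf_chart \<epsilon> ` (closed_segment x x' \<times> {k}) :: annulus set"
    have ends: "cover2 (F z) \<in> ?arc" "cover2 (F z') \<in> ?arc" using z by auto
    have "cover2 (leaf_chart \<epsilon> (t, k)) \<in> \<L> k" for t
      by (simp add: leaf_iff) (simp add: leaf_chart_def)
    then have "?arc \<subseteq> \<L> k" by blast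
    moreover have "?arc \<subseteq> V"
    proof -
      have "cover2 ` F ` W \<subseteq> V" using F(4) W(4) surj by auto
      then show ?thesis using arc by blast
    qed
    ultimately have sub: "?arc \<subseteq> \<L> k \<inter> V" by blast
    have ne: "\<L> k \<inter> V \<noteq> {}" using sub ends by blast
    have "connected ?arc"
      by (intro connected_continuous_image continuous_on_cover2 continuous_leaf_chart connected_Times connected_segment connected_sing)
    from exists_component_superset[OF sub ne this]
    obtain Y where Y: "Y \<in> components (\<L> k \<inter> V)" "?arc \<subseteq> Y" by blast
    then have "Y \<in> restrict_foliation (range \<L>) V" by (auto simp: restrict_foliation_def)
    then obtain X where X': "X \<in> restrict_foliation horizontal_foliation U" "Y = \<Phi> ` X"
      unfolding leaves[symmetric] by (rule imageE)
    then obtain c where X: "X \<in> components (UNIV \<times> {c} \<inter> U)" "Y = \<Phi> ` X"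
      unfolding restrict_foliation_def horizontal_foliation_def by blast
    have Xsub: "X \<subseteq> UNIV \<times> {c}" "X \<subseteq> U" using in_components_subset[OF X(1)] by auto
    have "snd w = c" if w: "w \<in> W" "cover2 (F w) \<in> ?arc" for w
    proof -
      obtain r where "r \<in> X" "\<Phi> r = \<Phi> (cover2 w)" using w Y(2) X(2) F(4) by (metis imageE subsetD)
      then have "cover2 w \<in> X" using inj Xsub(2) W(4) w(1) by (metis image_eqI inj_onD subsetD)
      then show ?thesis using Xsub(1) by (auto simp: cover2_def)
    qed
    then show ?thesis using z ends by metis
  qed
  have P_image: "leaf_chart \<epsilon> (x0, c0) \<in> F ` W" using F(3) W(3) by (metis imageI)
  have "\<exists>d>0. \<forall>l\<in>{c0-d<..<c0+d}. \<exists>D. (pair_quotient \<epsilon> \<longlongrightarrow> D) (at_diagonal l)"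
    by (rule strict_derivative_of_plane_straightening[OF W(1) F(1,2) area to_leaf to_line P_image])
  then obtain d where d: "d > 0" "\<forall>l\<in>{c0-d<..<c0+d}. \<exists>D. (pair_quotient \<epsilon> \<longlongrightarrow> D) (at_diagonal l)"
    by blast
  show thesis
  proof (rule C1_of_strict_derivative)
    show "\<exists>D. (pair_quotient \<epsilon> \<longlongrightarrow> D) (at_diagonal l)" if "l \<in> {c0-d<..<c0+d}" for l
      using d(2) that by (rule bspec)
  qed (rule that[OF d(1)])
qed

text \<open>The neighbourhood can be taken invariant under rotation: the generating function is \<open>\<epsilon>(c)\<close> times a smooth
  function of the angle, so its regularity at \<open>(\<theta>0, c0)\<close> follows from that of \<open>\<epsilon>\<close> near \<open>c0\<close>.\<close>

theorem (in slow_lipschitz) straightening_imp_generating_C1: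
  fixes \<Phi> :: "'a::line_cover \<times> real \<Rightarrow> annulus"
  assumes "straightens_oriented U V (range (\<lambda>c. leaf_of (\<lambda>\<theta>. c + \<epsilon> c * cos_turn \<theta>))) \<Phi>"
    and "(\<theta>0, c0 + \<epsilon> c0 * cos_turn \<theta>0) \<in> V"
  shows "\<exists>W. open W \<and> (\<theta>0, c0) \<in> W \<and> C1_function_on W (\<lambda>(\<theta>, c). \<epsilon> c / (2 * pi) * sin_turn \<theta>)"
proof (rule straightening_imp_C1[OF assms])
  fix d :: real and D
  assume d: "d > 0" and D: "\<And>l. l \<in> {c0-d<..<c0+d} \<Longrightarrow> (\<epsilon> has_real_derivative D l) (at l)"
    "continuous_on {c0-d<..<c0+d} D"
  let ?W = "UNIV \<times> {c0-d<..<c0+d} :: annulus set"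
  have "C1_function_on ?W (\<lambda>(\<theta>, c). \<epsilon> c / (2 * pi) * sin_turn \<theta>)"
    by (rule C1_function_on_generating[OF D])
  moreover have "open ?W" by (intro open_Times) auto
  ultimately show ?thesis using d by (intro exI[of _ ?W]) auto
qed

theorem corollary1p2:
  fixes \<epsilon> :: "real \<Rightarrow> real"
    and \<F> :: "annulus set set"
    and u :: "annulus \<Rightarrow> real"
  assumes not_C1: "\<not> \<epsilon> C1_differentiable_on UNIV"
    and lipschitz: "(1 / (4 * pi))-lipschitz_on UNIV \<epsilon>"
    and foliation: "\<F> = range (\<lambda>c. leaf_of (\<lambda>\<theta>. c + \<epsilon> c * cos_turn \<theta>))"
    and u: "u = (\<lambda>(\<theta>, c). \<epsilon> c / (2 * pi) * sin_turn \<theta>)"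
  shows "continuous_graph_foliation \<F> \<and> generating_function \<F> u \<and>
    \<not> (\<exists>\<Phi> :: annulus \<Rightarrow> annulus. straightens_oriented UNIV UNIV \<F> \<Phi>) \<and>
    (\<forall>\<theta>\<^sub>0 c\<^sub>0. \<not> (\<exists>W. open W \<and> (\<theta>\<^sub>0, c\<^sub>0) \<in> W \<and> C1_function_on W u) \<longrightarrow>
      (\<forall>V. open V \<and> (\<theta>\<^sub>0, c\<^sub>0 + \<epsilon> c\<^sub>0 * cos_turn \<theta>\<^sub>0) \<in> V \<longrightarrow>
        \<not> (\<exists>U (\<Phi> :: annulus \<Rightarrow> annulus). straightens_oriented U V \<F> \<Phi>) \<and>
        \<not> (\<exists>U (\<Phi> :: plane \<Rightarrow> annulus). straightens_oriented U V \<F> \<Phi>)))"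
proof -
  interpret slow_lipschitz \<epsilon> using lipschitz by unfold_locales
  have no_global: "\<not> straightens_oriented UNIV UNIV \<F> \<Phi>" for \<Phi> :: "annulus \<Rightarrow> annulus"
  proof
    assume st: "straightens_oriented UNIV UNIV \<F> \<Phi>"
    have local: "\<exists>d>0. \<exists>D. (\<forall>l\<in>{c-d<..<c+d}. (\<epsilon> has_real_derivative D l) (at l)) \<and> continuous_on {c-d<..<c+d} D" for c
      using straightening_imp_C1[OF st[unfolded foliation], of "cover 0" c] by (metis UNIV_I)
    then have "(\<epsilon> has_real_derivative deriv \<epsilon> c) (at c)" for c
      using local[of c] by (metis DERIV_imp_deriv add.commute greaterThanLessThan_iff less_add_same_cancel1 diff_less_eq)
    moreover have "isCont (deriv \<epsilon>) c" for c
    proof -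
      obtain d D where d: "d > 0" and D: "\<And>l. l \<in> {c-d<..<c+d} \<Longrightarrow> (\<epsilon> has_real_derivative D l) (at l)"
        "continuous_on {c-d<..<c+d} D" using local[of c] by blast
      have "continuous_on {c-d<..<c+d} (deriv \<epsilon>)"
        using D(2) by (rule continuous_on_eq) (metis D(1) DERIV_imp_deriv)
      then show ?thesis using d by (simp add: continuous_on_eq_continuous_at)
    qed
    ultimately have "\<epsilon> C1_differentiable_on UNIV"
      unfolding C1_differentiable_on_def
      by (intro exI[of _ "deriv \<epsilon>"])
         (auto simp: has_real_derivative_iff_has_vector_derivative continuous_at_imp_continuous_on)
    with not_C1 show False ..
  qed
  show ?thesis
    unfolding u
  proof (intro conjI allI impI)
    show "continuous_graph_foliation \<F>" "generating_function \<F> (\<lambda>(\<theta>, c). \<epsilon> c / (2 * pi) * sin_turn \<theta>)"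
      unfolding foliation by (rule continuous_graph_foliation_of_heights generating_function_of_heights)+
    show "\<not> (\<exists>\<Phi> :: annulus \<Rightarrow> annulus. straightens_oriented UNIV UNIV \<F> \<Phi>)"
      using no_global by blast
    fix \<theta>0 c0 V
    assume sing: "\<not> (\<exists>W. open W \<and> (\<theta>0, c0) \<in> W \<and> C1_function_on W (\<lambda>(\<theta>, c). \<epsilon> c / (2 * pi) * sin_turn \<theta>))"
      and V: "open V \<and> (\<theta>0, c0 + \<epsilon> c0 * cos_turn \<theta>0) \<in> V"
    show "\<not> (\<exists>U (\<Phi> :: annulus \<Rightarrow> annulus). straightens_oriented U V \<F> \<Phi>)"
      "\<not> (\<exists>U (\<Phi> :: plane \<Rightarrow> annulus). straightens_oriented U V \<F> \<Phi>)"
      using straightening_imp_generating_C1[of _ V _ \<theta>0 c0] sing V unfolding foliation by blast+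
  qed
qed

end
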